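(* Let $ABC$ be a nondegenerate triangle in $\mathbb{R}^2$, let $X_{\mathrm{Mal}}\in\mathbb{R}^9$ be its Malfatti configuration, and for $-1<q<1$ let $T_q$ be the simultaneous LC–CC update map with contraction parameter $q$ (as defined in the context). Let $$M=\frac12\sum_{k=1}^{6}\nabla l_k(X_{\mathrm{Mal}})\nabla l_k(X_{\mathrm{Mal}})^{T}+\frac14\sum_{(i,j)\in\{(1,2),(2,3),(1,3)\}}\nabla c_{ij}(X_{\mathrm{Mal}})\nabla c_{ij}(X_{\mathrm{Mal}})^{T},$$ a symmetric $9\times 9$ matrix, where $l_1,\dots,l_6$ are the line–circle contact errors and $c_{ij}$ the circle–circle contact errors, and let $\lambda_{\max}(M)$ be its largest eigenvalue. (1) $X_{\mathrm{Mal}}$ is a locally asymptotically stable fixed point of $T_q$ whenever $-1<q<1$ and $$1-\frac{2}{\lambda_{\max}(M)}<q<1.$$ (2) Furthermore, the triangle-independent condition $\frac12<q<1$ guarantees that $X_{\mathrm{Mal}}$ is a locally asymptotically stable fixed point of $T_q$, for every nondegenerate triangle $ABC$.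
   Context: States. A state is a vector $X=(P_1,r_1,P_2,r_2,P_3,r_3)\in\mathbb{R}^9$ with $P_i\in\mathbb{R}^2$ (center of the circle $C_i$) and $r_i\in\mathbb{R}$ (its radius). $\mathbb{R}^9$ carries the Euclidean norm. Malfatti configuration. For a nondegenerate triangle $ABC$, the Malfatti circles are the three circles $C_1,C_2,C_3$ contained in the closed triangle, such that $C_1$ is tangent to the sides $AB$ and $AC$, $C_2$ is tangent to $AB$ and $BC$, $C_3$ is tangent to $BC$ and $CA$, and $C_1,C_2,C_3$ are pairwise externally tangent. (Such a triple exists and is unique, a classical fact.) $X_{\mathrm{Mal}}$ is the corresponding state, with the (positive) radii and the centers of these circles. LC module with parameter $q$, for a circle with center $P$ and radius $r$ and a fixed line $L$ with $P\notin L$: let $h=\operatorname{dist}(P,L)$, $d=r-h$ (line–circle contact error), and let $\mathbf{n}$ be the unit vector perpendicular to $L$ pointing from $L$ toward $P$. The module produces the correction $\Delta P=\frac{(1-q)d}{2}\mathbf{n}$, $\Delta r=-\frac{(1-q)d}{2}$. CC module with parameter $q$, for two circles with centers $P_i\ne P_j$ and radii $r_i,r_j$: let $d=\|P_j-P_i\|-r_i-r_j$ (circle–circle contact error) and $\mathbf{u}=\frac{P_j-P_i}{\|P_j-P_i\|}$. The module produces the corrections $\Delta P_i=\frac{1-q}{4}d\,\mathbf{u}$, $\Delta P_j=-\frac{1-q}{4}d\,\mathbf{u}$, $\Delta r_i=\Delta r_j=\frac{1-q}{4}d$. Update map. $T_q(X)$ is obtained from $X$ by adding to $X$ the sum of the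 corrections, all evaluated at the same current state $X$, of the following nine modules: the six LC modules for the pairs (circle, line) $(C_1,AB)$, $(C_1,AC)$, $(C_2,AB)$, $(C_2,BC)$, $(C_3,BC)$, $(C_3,CA)$, where the lines are the lines through the sides of the triangle, and the three CC modules for the pairs $(C_1,C_2)$, $(C_2,C_3)$, $(C_1,C_3)$. $T_q$ is defined on the open set of states in which no center lies on a line used in its LC modules and the three centers are pairwise distinct; this set contains $X_{\mathrm{Mal}}$. Contact errors as functions. $l_1(X),\dots,l_6(X)$ are the six functions $r_i-\operatorname{dist}(P_i,L)$ for the six (circle, line) pairs $(C_i,L)$ listed above, and $c_{ij}(X)=\|P_i-P_j\|-r_i-r_j$ for $(i,j)\in\{(1,2),(2,3),(1,3)\}$. Gradients are taken with respect to all nine coordinates of $X$ and regarded as column vectors in $\mathbb{R}^9$. Terminology. A fixed point $X^*$ of $T$ is locally asymptotically stable if it is Lyapunov stable (for every neighborhood $V$ of $X^*$ there is a neighborhood $W$ of $X^*$ such that all iterates of every point of $W$ are defined and stay in $V$) and there is a neighborhood of $X^*$ such that the iterates of every point of it are defined and converge to $X^*$. *)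

theory Defs
  imports "HOL-Analysis.Analysis"
begin

section \<open>States\<close>

text \<open>
  A state \<open>(P\<^sub>1, r\<^sub>1, P\<^sub>2, r\<^sub>2, P\<^sub>3, r\<^sub>3)\<close> is a vector in \<open>real ^ 9\<close>; the circle with index \<open>i\<close> occupies the
  coordinates \<open>3i - 2, 3i - 1\<close> (centre) and \<open>3i\<close> (radius). Numerals of type \<open>3\<close> and \<open>9\<close> are read
  modulo 3 and 9, so the last circle has index \<open>3 = 0\<close> and the last coordinate is \<open>9 = 0\<close>.
\<close>

definition center :: "real ^ 9 \<Rightarrow> 3 \<Rightarrow> real ^ 2" where
  "center X i =
    (if i = 1 then vector [X $ 1, X $ 2]
     else if i = 2 then vector [X $ 4, X $ 5]
     else vector [X $ 7, X $ 8])"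

definition radius :: "real ^ 9 \<Rightarrow> 3 \<Rightarrow> real" where
  "radius X i = (if i = 1 then X $ 3 else if i = 2 then X $ 6 else X $ 9)"

text \<open>The state-space vector whose block for circle \<open>i\<close> is \<open>(p, s)\<close> and whose other blocks vanish.\<close>

definition circle_block :: "3 \<Rightarrow> real ^ 2 \<Rightarrow> real \<Rightarrow> real ^ 9" where
  "circle_block i p s =
    (if i = 1 then vector [p $ 1, p $ 2, s, 0, 0, 0, 0, 0, 0]
     else if i = 2 then vector [0, 0, 0, p $ 1, p $ 2, s, 0, 0, 0]
     else vector [0, 0, 0, 0, 0, 0, p $ 1, p $ 2, s])"

section \<open>Contacts and the Malfatti configuration\<close>

definition line_contacts :: "real ^ 2 \<Rightarrow> real ^ 2 \<Rightarrow> real ^ 2 \<Rightarrow> (3 \<times> (real ^ 2) \<times> (real ^ 2)) list" where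
  "line_contacts A B C = [(1, A, B), (1, A, C), (2, A, B), (2, B, C), (3, B, C), (3, C, A)]"

definition circle_contacts :: "(3 \<times> 3) list" where
  "circle_contacts = [(1, 2), (2, 3), (1, 3)]"

definition line_through :: "real ^ 2 \<Rightarrow> real ^ 2 \<Rightarrow> (real ^ 2) set" where
  "line_through U V = affine hull {U, V}"

definition tangent_to_side :: "real ^ 2 \<Rightarrow> real \<Rightarrow> real ^ 2 \<Rightarrow> real ^ 2 \<Rightarrow> bool" where
  "tangent_to_side P r U V \<longleftrightarrow>
    (\<exists>t \<in> closed_segment U V. sphere P r \<inter> line_through U V = {t})"

definition externally_tangent :: "real ^ 2 \<Rightarrow> real \<Rightarrow> real ^ 2 \<Rightarrow> real \<Rightarrow> bool" where
  "externally_tangent P r Q s \<longleftrightarrow>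
    (\<exists>t. sphere P r \<inter> sphere Q s = {t}) \<and> ball P r \<inter> ball Q s = {}"

definition malfatti_configuration :: "real ^ 2 \<Rightarrow> real ^ 2 \<Rightarrow> real ^ 2 \<Rightarrow> real ^ 9 \<Rightarrow> bool" where
  "malfatti_configuration A B C X \<longleftrightarrow>
    (\<forall>i. radius X i > 0) \<and>
    (\<forall>i. sphere (center X i) (radius X i) \<subseteq> convex hull {A, B, C}) \<and>
    (\<forall>(i, U, V) \<in> set (line_contacts A B C). tangent_to_side (center X i) (radius X i) U V) \<and>
    (\<forall>(i, j) \<in> set circle_contacts.
      externally_tangent (center X i) (radius X i) (center X j) (radius X j))"

section \<open>Contact errors\<close>

definition line_error :: "3 \<Rightarrow> (real ^ 2) set \<Rightarrow> real ^ 9 \<Rightarrow> real" where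
  "line_error i L X = radius X i - infdist (center X i) L"

definition circle_error :: "3 \<Rightarrow> 3 \<Rightarrow> real ^ 9 \<Rightarrow> real" where
  "circle_error i j X = norm (center X j - center X i) - radius X i - radius X j"

section \<open>The update map\<close>

text \<open>The unit vector perpendicular to the line \<open>L\<close> pointing from \<open>L\<close> toward \<open>P\<close> (for \<open>P \<notin> L\<close>).\<close>

definition line_normal :: "real ^ 2 \<Rightarrow> (real ^ 2) set \<Rightarrow> real ^ 2" where
  "line_normal P L =
    (THE n. norm n = 1 \<and> (\<forall>x\<in>L. \<forall>y\<in>L. n \<bullet> (x - y) = 0) \<and> (\<forall>x\<in>L. n \<bullet> (P - x) > 0))"

definition lc_module :: "real \<Rightarrow> 3 \<Rightarrow> (real ^ 2) set \<Rightarrow> real ^ 9 \<Rightarrow> real ^ 9" where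
  "lc_module q i L X =
    (let d = line_error i L X;
         n = line_normal (center X i) L
     in circle_block i (((1 - q) * d / 2) *\<^sub>R n) (- ((1 - q) * d / 2)))"

definition cc_module :: "real \<Rightarrow> 3 \<Rightarrow> 3 \<Rightarrow> real ^ 9 \<Rightarrow> real ^ 9" where
  "cc_module q i j X =
    (let d = circle_error i j X;
         u = (1 / norm (center X j - center X i)) *\<^sub>R (center X j - center X i);
         c = (1 - q) / 4 * d
     in circle_block i (c *\<^sub>R u) c + circle_block j (- (c *\<^sub>R u)) c)"

definition update_map :: "real ^ 2 \<Rightarrow> real ^ 2 \<Rightarrow> real ^ 2 \<Rightarrow> real \<Rightarrow> real ^ 9 \<Rightarrow> real ^ 9" where
  "update_map A B C q X =
    X + (\<Sum>(i, U, V)\<leftarrow>line_contacts A B C. lc_module q i (line_through U V) X)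
      + (\<Sum>(i, j)\<leftarrow>circle_contacts. cc_module q i j X)"

text \<open>The map is only meaningful on the following set; outside it, its values are irrelevant.\<close>

definition update_domain :: "real ^ 2 \<Rightarrow> real ^ 2 \<Rightarrow> real ^ 2 \<Rightarrow> (real ^ 9) set" where
  "update_domain A B C =
    {X. (\<forall>(i, U, V) \<in> set (line_contacts A B C). center X i \<notin> line_through U V) \<and>
        inj (center X)}"

section \<open>Stability of fixed points of partial maps\<close>

text \<open>
  The map \<open>T\<close> is regarded as partial with domain \<open>D\<close>: all iterates of \<open>y\<close> are defined iff
  \<open>(T ^^ n) y \<in> D\<close> for every \<open>n\<close>.
\<close>

definition lyapunov_stable :: "('a::topological_space \<Rightarrow> 'a) \<Rightarrow> 'a set \<Rightarrow> 'a \<Rightarrow> bool" where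
  "lyapunov_stable T D x \<longleftrightarrow>
    (\<forall>V. open V \<and> x \<in> V \<longrightarrow>
      (\<exists>W. open W \<and> x \<in> W \<and> (\<forall>y\<in>W. \<forall>n. (T ^^ n) y \<in> D \<and> (T ^^ n) y \<in> V)))"

definition locally_attracting :: "('a::topological_space \<Rightarrow> 'a) \<Rightarrow> 'a set \<Rightarrow> 'a \<Rightarrow> bool" where
  "locally_attracting T D x \<longleftrightarrow>
    (\<exists>W. open W \<and> x \<in> W \<and>
      (\<forall>y\<in>W. (\<forall>n. (T ^^ n) y \<in> D) \<and> (\<lambda>n. (T ^^ n) y) \<longlonglongrightarrow> x))"

definition locally_asymptotically_stable_fixed_point ::
    "('a::topological_space \<Rightarrow> 'a) \<Rightarrow> 'a set \<Rightarrow> 'a \<Rightarrow> bool" where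
  "locally_asymptotically_stable_fixed_point T D x \<longleftrightarrow>
    x \<in> D \<and> T x = x \<and> lyapunov_stable T D x \<and> locally_attracting T D x"

section \<open>The matrix \<open>M\<close> and its largest eigenvalue\<close>

definition gradient :: "('a::real_inner \<Rightarrow> real) \<Rightarrow> 'a \<Rightarrow> 'a" where
  "gradient f x = (THE D. GDERIV f x :> D)"

definition outer_square :: "real ^ 'n \<Rightarrow> real ^ 'n ^ 'n" where
  "outer_square v = (columnvector v :: real ^ 1 ^ 'n) ** rowvector v"

definition malfatti_matrix :: "real ^ 2 \<Rightarrow> real ^ 2 \<Rightarrow> real ^ 2 \<Rightarrow> real ^ 9 \<Rightarrow> real ^ 9 ^ 9" where
  "malfatti_matrix A B C X =
    (1 / 2) *\<^sub>R (\<Sum>(i, U, V)\<leftarrow>line_contacts A B C.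
                  outer_square (gradient (line_error i (line_through U V)) X)) +
    (1 / 4) *\<^sub>R (\<Sum>(i, j)\<leftarrow>circle_contacts. outer_square (gradient (circle_error i j) X))"

definition is_eigenvalue :: "real ^ 'n ^ 'n \<Rightarrow> real \<Rightarrow> bool" where
  "is_eigenvalue A c \<longleftrightarrow> (\<exists>v. v \<noteq> 0 \<and> A *v v = c *\<^sub>R v)"

text \<open>Meaningful for symmetric \<open>A\<close>, whose set of real eigenvalues is finite and nonempty.\<close>

definition max_eigenvalue :: "real ^ 'n ^ 'n \<Rightarrow> real" where
  "max_eigenvalue A = Max {c. is_eigenvalue A c}"

end

theory Submission
  imports Defs
begin

text \<open>
  Near \<open>X_Mal\<close> each module subtracts a multiple of (error) * (gradient of the error), and all errors vanish
  at \<open>X_Mal\<close>, so the derivative of \<open>T\<close> there is \<open>I - (1 - q) M\<close>. It suffices that \<open>M\<close> is positive definite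
  and that its Rayleigh quotient is below \<open>2 / (1 - q)\<close>; the latter holds if \<open>q > 1 / 2\<close> because the
  quotient is at most 4 (each circle has two contacts of either kind, and each kind contributes at most 2).

  For definiteness, the nine gradients must be independent. A vector orthogonal to the six line gradients
  moves every circle by a homothety about its vertex, with some rate \<open>t\<^sub>i\<close>. Along each side the circles
  appear in the order of the vertices, and then orthogonality to the gradient of \<open>c\<^sub>i\<^sub>j\<close> forces \<open>t\<^sub>i\<close> and \<open>t\<^sub>j\<close>
  to have opposite signs. Going around the triangle, an odd number of sign changes gives \<open>t = 0\<close>.
\<close>

section \<open>Symmetric maps and linearised stability\<close>

text \<open>The form is nonnegative at \<open>l *\<^sub>R v - f v\<close>; expanding it there and
  bounding the form at \<open>f v\<close> by \<open>upper\<close> leaves \<open>l\<close> times the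
  claim. This is the operator inequality f^2 \<le> l f, obtained without diagonalising
  \<open>f\<close>.\<close>

lemma norm_sq_le_of_psd:
  fixes f :: "'a::real_inner \<Rightarrow> 'a"
  assumes lin: "linear f" and sym: "\<And>x y. f x \<bullet> y = x \<bullet> f y"
    and nonneg: "\<And>v. 0 \<le> v \<bullet> f v" and upper: "\<And>v. v \<bullet> f v \<le> l * (v \<bullet> v)" and "0 < l"
  shows "f v \<bullet> f v \<le> l * (v \<bullet> f v)"
proof -
  define w where "w = l *\<^sub>R v - f v"
  have fw: "f w = l *\<^sub>R f v - f (f v)"
    by (simp add: w_def linear_diff[OF lin] linear_scale[OF lin])
  have "w \<bullet> f w = l\<^sup>2 * (v \<bullet> f v) - 2 * l * (f v \<bullet> f v) + f v \<bullet> f (f v)"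
    using sym[of v "f v"] unfolding fw unfolding w_def
    by (simp add: inner_diff_left inner_diff_right power2_eq_square inner_commute algebra_simps)
  moreover have "f v \<bullet> f (f v) \<le> l * (f v \<bullet> f v)"
    by (rule upper)
  ultimately have "0 \<le> l * (l * (v \<bullet> f v) - f v \<bullet> f v)"
    using nonneg[of w] by (simp add: power2_eq_square algebra_simps)
  then show ?thesis
    using \<open>0 < l\<close> by (simp add: zero_le_mult_iff)
qed

text \<open>By compactness the norm of \<open>f\<close> attains its maximum on the unit sphere, and
  the strict inequality at the maximiser becomes a uniform factor below 1.\<close>

lemma linear_unit_sphere_bound:
  fixes f :: "'a::euclidean_space \<Rightarrow> 'b::real_normed_vector"
  assumes lin: "linear f" and less: "\<And>v. v \<noteq> 0 \<Longrightarrow> norm (f v) < norm v"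
  shows "\<exists>r. 0 \<le> r \<and> r < 1 \<and> (\<forall>v. norm (f v) \<le> r * norm v)"
proof -
  have bl: "bounded_linear f"
    using lin by (simp add: linear_conv_bounded_linear)
  obtain b :: 'a where "b \<in> Basis"
    using nonempty_Basis by blast
  then have "sphere (0::'a) 1 \<noteq> {}"
    using norm_Basis[of b] by auto
  moreover have "continuous_on (sphere 0 1) (\<lambda>v. norm (f v))"
    by (intro continuous_on_norm linear_continuous_on bl)
  ultimately obtain z where z: "z \<in> sphere 0 1" "\<And>v. v \<in> sphere 0 1 \<Longrightarrow> norm (f v) \<le> norm (f z)"
    using continuous_attains_sup[OF compact_sphere] by metis
  have "norm (f v) \<le> norm (f z) * norm v" for v
  proof (cases "v = 0")
    case True
    then show ?thesis using linear_0[OF lin] by simp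
  next
    case False
    have "f v = norm v *\<^sub>R f (sgn v)"
      using False by (simp add: sgn_div_norm linear_scale[OF lin])
    then show ?thesis
      using z(2)[of "sgn v"] False by (simp add: norm_sgn mult.commute mult_right_mono)
  qed
  moreover have "norm (f z) < 1"
    using less[of z] z(1) by force
  ultimately show ?thesis
    by (intro exI[of _ "norm (f z)"]) auto
qed

text \<open>Expanding the square and applying \<open>norm_sq_le_of_psd\<close> to the quadratic term
  in \<open>k\<close> shows that the squared norm drops by at least
  \<open>k * (2 - k * l) * (v \<bullet> f v)\<close>, which is positive for
  \<open>v \<noteq> 0\<close>.\<close>

lemma pos_def_relaxation_contracts:
  fixes f :: "'a::euclidean_space \<Rightarrow> 'a"
  assumes lin: "linear f" and sym: "\<And>x y. f x \<bullet> y = x \<bullet> f y"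
    and pos: "\<And>v. v \<noteq> 0 \<Longrightarrow> 0 < v \<bullet> f v" and upper: "\<And>v. v \<bullet> f v \<le> l * (v \<bullet> v)"
    and "0 < l" "0 < k" "k * l < 2"
  shows "\<exists>r. 0 \<le> r \<and> r < 1 \<and> (\<forall>v. norm (v - k *\<^sub>R f v) \<le> r * norm v)"
proof (rule linear_unit_sphere_bound)
  show "linear (\<lambda>v. v - k *\<^sub>R f v)"
    using lin by (intro linear_compose_sub linear_ident linear_compose_scale_right)
next
  fix v :: 'a
  assume "v \<noteq> 0"
  have nonneg: "0 \<le> w \<bullet> f w" for w
    using pos[of w] by (cases "w = 0") auto
  have "(v - k *\<^sub>R f v) \<bullet> (v - k *\<^sub>R f v) = v \<bullet> v - 2 * k * (v \<bullet> f v) + k * (k * (f v \<bullet> f v))"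
    by (simp add: inner_diff_left inner_diff_right inner_commute algebra_simps)
  also have "\<dots> \<le> v \<bullet> v - 2 * k * (v \<bullet> f v) + k * (k * (l * (v \<bullet> f v)))"
    using norm_sq_le_of_psd[OF lin sym nonneg upper \<open>0 < l\<close>] \<open>0 < k\<close> by simp
  also have "\<dots> = v \<bullet> v - (k * (2 - k * l)) * (v \<bullet> f v)"
    by (simp add: algebra_simps)
  also have "\<dots> < v \<bullet> v"
    using pos[OF \<open>v \<noteq> 0\<close>] \<open>0 < k\<close> \<open>k * l < 2\<close> by simp
  finally show "norm (v - k *\<^sub>R f v) < norm v"
    by (simp add: norm_lt)
qed

section \<open>Eigenvalues and the Rayleigh quotient\<close>

text \<open>Eigenvectors of distinct eigenvalues are orthogonal, hence independent, so there are
  finitely many. Finiteness gives meaning to the \<open>Max\<close> in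
  \<open>max_eigenvalue\<close>.\<close>

lemma finite_eigenvalues_symmetric:
  fixes M :: "real ^ 'n ^ 'n"
  assumes sym: "\<And>x y. (M *v x) \<bullet> y = x \<bullet> (M *v y)"
  shows "finite {c. is_eigenvalue M c}"
proof -
  have "\<forall>c\<in>{c. is_eigenvalue M c}. \<exists>v. v \<noteq> 0 \<and> M *v v = c *\<^sub>R v"
    by (simp add: is_eigenvalue_def)
  then obtain w where w: "\<And>c. is_eigenvalue M c \<Longrightarrow> w c \<noteq> 0 \<and> M *v w c = c *\<^sub>R w c"
    by (metis mem_Collect_eq)
  have orth: "w c \<bullet> w d = 0" if "is_eigenvalue M c" "is_eigenvalue M d" "c \<noteq> d" for c d
    using sym[of "w c" "w d"] w[OF that(1)] w[OF that(2)] that(3) by simp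
  have inj: "inj_on w {c. is_eigenvalue M c}"
  proof (rule inj_onI, rule ccontr)
    fix c d
    assume cd: "c \<in> {c. is_eigenvalue M c}" "d \<in> {c. is_eigenvalue M c}" "w c = w d" "c \<noteq> d"
    then have "w c \<bullet> w c = 0"
      using orth[of c d] by simp
    then show False
      using w[of c] cd(1) by simp
  qed
  have "pairwise orthogonal (w ` {c. is_eigenvalue M c})"
    using orth by (auto simp: pairwise_def orthogonal_def)
  moreover have "0 \<notin> w ` {c. is_eigenvalue M c}"
    using w by auto
  ultimately have "finite (w ` {c. is_eigenvalue M c})"
    using pairwise_orthogonal_independent independent_imp_finite by blast
  then show ?thesis
    using inj finite_imageD by blast
qed

text \<open>A maximiser of the quadratic form on the unit sphere is an eigenvector, so the maximum
  \<open>l\<close> of the Rayleigh quotient is itself an eigenvalue.\<close>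

lemma rayleigh_le_max_eigenvalue:
  fixes M :: "real ^ 'n ^ 'n"
  assumes sym: "\<And>x y. (M *v x) \<bullet> y = x \<bullet> (M *v y)"
  shows "v \<bullet> (M *v v) \<le> max_eigenvalue M * (v \<bullet> v)"
proof -
  let ?S = "sphere (0 :: real ^ 'n) 1"
  obtain b :: "real ^ 'n" where "b \<in> Basis"
    using nonempty_Basis by blast
  then have "?S \<noteq> {}"
    using norm_Basis[of b] by auto
  moreover have "continuous_on ?S (\<lambda>v. v \<bullet> (M *v v))"
    by (intro continuous_on_inner continuous_on_id linear_continuous_on matrix_vector_mul_bounded_linear)
  ultimately have "\<exists>z\<in>?S. \<forall>v\<in>?S. v \<bullet> (M *v v) \<le> z \<bullet> (M *v z)"
    by (rule continuous_attains_sup[OF compact_sphere])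
  then obtain z where z: "z \<in> ?S" "\<And>v. v \<in> ?S \<Longrightarrow> v \<bullet> (M *v v) \<le> z \<bullet> (M *v z)"
    by blast
  define l where "l = z \<bullet> (M *v z)"
  have ray: "v \<bullet> (M *v v) \<le> l * (v \<bullet> v)" for v
  proof (cases "v = 0")
    case False
    have "sgn v \<in> ?S"
      using False by (simp add: norm_sgn)
    then have "sgn v \<bullet> (M *v sgn v) \<le> l"
      using z(2) l_def by blast
    moreover have "v \<bullet> (M *v v) = (norm v)\<^sup>2 * (sgn v \<bullet> (M *v sgn v))"
      using False by (simp add: sgn_div_norm matrix_vector_mult_scaleR power2_eq_square field_simps)
    ultimately show ?thesis
      using mult_left_mono[of "sgn v \<bullet> (M *v sgn v)" l "(norm v)\<^sup>2"] by (simp add: dot_square_norm mult.commute)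
  qed simp
  \<comment> \<open>\<open>f\<close> is positive semidefinite with \<open>z \<bullet> f z = 0\<close>, hence \<open>f z = 0\<close>.\<close>
  define f where "f = (\<lambda>v. l *\<^sub>R v - M *v v)"
  have lin: "linear f"
    unfolding f_def
    by (intro linear_compose_sub linear_compose_scale_right linear_ident matrix_vector_mul_linear)
  \<comment> \<open>Any bound on the quadratic form of \<open>f\<close> serves in
    \<open>norm_sq_le_of_psd\<close>; an operator bound is one by Cauchy-Schwarz.\<close>
  obtain K where K: "0 < K" "\<And>v. norm (f v) \<le> norm v * K"
    using bounded_linear.pos_bounded[of f] lin unfolding linear_conv_bounded_linear by blast
  have "f z \<bullet> f z \<le> K * (z \<bullet> f z)"
  proof (rule norm_sq_le_of_psd[OF lin])
    show "f x \<bullet> y = x \<bullet> f y" for x y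
      by (simp add: f_def inner_diff_left inner_diff_right sym)
    show "0 \<le> v \<bullet> f v" for v
      using ray[of v] by (simp add: f_def inner_diff_right)
    show "v \<bullet> f v \<le> K * (v \<bullet> v)" for v
    proof -
      have "v \<bullet> f v \<le> norm v * norm (f v)"
        by (rule norm_cauchy_schwarz)
      also have "\<dots> \<le> norm v * (norm v * K)"
        by (intro mult_left_mono K) simp
      finally show ?thesis
        by (simp add: dot_square_norm power2_eq_square mult_ac)
    qed
  qed (rule K)
  moreover have "z \<bullet> f z = 0"
    using z(1) by (simp add: f_def inner_diff_right l_def dot_square_norm)
  ultimately have "f z = 0"
    by (simp add: dot_square_norm)
  then have "is_eigenvalue M l"
    using z(1) unfolding is_eigenvalue_def f_def by (intro exI[of _ z]) (simp, force)
  then have "l \<le> max_eigenvalue M"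
    unfolding max_eigenvalue_def using finite_eigenvalues_symmetric[OF sym] by (intro Max_ge) auto
  then have "l * (v \<bullet> v) \<le> max_eigenvalue M * (v \<bullet> v)"
    by (intro mult_right_mono) auto
  with ray[of v] show ?thesis
    by (rule order_trans)
qed

section \<open>Stability from the linearisation\<close>

text \<open>Near \<open>x\<close> the map itself contracts distances to \<open>x\<close> by a factor
  slightly larger than \<open>r\<close>. Iterates therefore stay in every small ball around
  \<open>x\<close> and converge geometrically, which yields both halves of stability at
  once.\<close>

lemma linearly_stable_fixed_point:
  fixes T :: "'a::real_normed_vector \<Rightarrow> 'a"
  assumes D: "open D" "x \<in> D" and fixed: "T x = x" and der: "(T has_derivative T') (at x)"
    and contr: "0 \<le> r" "r < 1" "\<And>v. norm (T' v) \<le> r * norm v"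
  shows "locally_asymptotically_stable_fixed_point T D x"
proof -
  \<comment> \<open>Any rate strictly between \<open>r\<close> and 1 works; the slack
    \<open>s - r\<close> absorbs the remainder of the derivative.\<close>
  define s where "s = (1 + r) / 2"
  have s: "0 \<le> s" "s < 1" "0 < s - r"
    using contr by (auto simp: s_def)
  obtain d where d: "0 < d" "\<And>y. norm (y - x) < d \<Longrightarrow> norm (T y - T x - T' (y - x)) \<le> (s - r) * norm (y - x)"
    using der s(3) unfolding has_derivative_at_alt by blast
  have step: "norm (T y - x) \<le> s * norm (y - x)" if "norm (y - x) < d" for y
  proof -
    have "norm (T y - x) \<le> norm (T y - T x - T' (y - x)) + norm (T' (y - x))"
      using norm_triangle_ineq[of "T y - T x - T' (y - x)" "T' (y - x)"] by (simp add: fixed)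
    also have "\<dots> \<le> (s - r) * norm (y - x) + r * norm (y - x)"
      using d(2)[OF that] contr(3) by (rule add_mono)
    finally show ?thesis
      by (simp add: algebra_simps)
  qed
  have iter: "norm ((T ^^ n) y - x) \<le> s ^ n * norm (y - x)" if "norm (y - x) < d" for y n
  proof (induction n)
    case (Suc n)
    have "s ^ n * norm (y - x) \<le> norm (y - x)"
      using s by (simp add: mult_left_le_one_le power_le_one)
    then have "norm ((T ^^ n) y - x) < d"
      using Suc that by linarith
    then have "norm ((T ^^ Suc n) y - x) \<le> s * norm ((T ^^ n) y - x)"
      using step by simp
    also have "\<dots> \<le> s * (s ^ n * norm (y - x))"
      using Suc s(1) by (rule mult_left_mono)
    finally show ?case
      by simp
  qed simp
  have stay: "(T ^^ n) y \<in> ball x e" if "y \<in> ball x e" "e \<le> d" for y n e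
  proof -
    have "norm (y - x) < e"
      using that by (simp add: dist_norm norm_minus_commute)
    moreover have "s ^ n * norm (y - x) \<le> norm (y - x)"
      using s by (simp add: mult_left_le_one_le power_le_one)
    ultimately show ?thesis
      using iter[of y n] that(2) by (simp add: dist_norm norm_minus_commute)
  qed
  \<comment> \<open>The ball must also lie in \<open>D\<close>, so that all iterates are
    defined.\<close>
  have nbhd: "\<exists>e>0. e \<le> d \<and> ball x e \<subseteq> D \<inter> V" if V: "open V" "x \<in> V" for V
  proof -
    obtain e where "0 < e" "ball x e \<subseteq> D \<inter> V"
      using openE[of "D \<inter> V" x] D V by blast
    then show ?thesis
      using d(1) by (intro exI[of _ "min d e"]) auto
  qed
  have "lyapunov_stable T D x"
    unfolding lyapunov_stable_def
  proof (intro allI impI, elim conjE)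
    fix V assume "open V" "x \<in> V"
    then obtain e where e: "0 < e" "e \<le> d" "ball x e \<subseteq> D \<inter> V"
      using nbhd by blast
    have "(T ^^ n) y \<in> D \<inter> V" if "y \<in> ball x e" for y n
      using stay[OF that e(2)] e(3) by (rule subsetD[rotated])
    then show "\<exists>W. open W \<and> x \<in> W \<and> (\<forall>y\<in>W. \<forall>n. (T ^^ n) y \<in> D \<and> (T ^^ n) y \<in> V)"
      using e(1) by (intro exI[of _ "ball x e"]) simp
  qed
  moreover have "locally_attracting T D x"
  proof -
    obtain e where e: "0 < e" "e \<le> d" "ball x e \<subseteq> D \<inter> UNIV"
      using nbhd[of UNIV] by blast
    have "(\<lambda>n. (T ^^ n) y) \<longlonglongrightarrow> x" if "y \<in> ball x e" for y
    proof -
      have "norm (y - x) < d"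
        using that e(2) by (simp add: dist_norm norm_minus_commute)
      then have "\<forall>\<^sub>F n in sequentially. norm ((T ^^ n) y - x) \<le> s ^ n * norm (y - x)"
        using iter by simp
      moreover have "(\<lambda>n. s ^ n * norm (y - x)) \<longlonglongrightarrow> 0"
        using s LIMSEQ_power_zero[of s] by (intro tendsto_mult_left_zero) simp
      ultimately have "(\<lambda>n. (T ^^ n) y - x) \<longlonglongrightarrow> 0"
        by (rule Lim_null_comparison)
      then show ?thesis
        by (simp only: LIM_zero_iff)
    qed
    moreover have "(T ^^ n) y \<in> D" if "y \<in> ball x e" for y n
      using subsetD[OF e(3) stay[OF that e(2)]] by simp
    ultimately show ?thesis
      unfolding locally_attracting_def using e(1) by (intro exI[of _ "ball x e"]) simp
  qed
  ultimately show ?thesis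
    using D fixed by (simp add: locally_asymptotically_stable_fixed_point_def)
qed

section \<open>Circles tangent to the sides of a triangle\<close>

text \<open>The third vertex \<open>W\<close> selects one of the two unit normals of the line
  \<open>U V\<close>; on its side of the line the distance is the affine function
  \<open>n \<bullet> (x - U)\<close>.\<close>

definition inward_normal :: "real ^ 2 \<Rightarrow> real ^ 2 \<Rightarrow> real ^ 2 \<Rightarrow> real ^ 2 \<Rightarrow> bool" where
  "inward_normal n U V W \<longleftrightarrow> U \<noteq> V \<and> norm n = 1 \<and> n \<bullet> (V - U) = 0 \<and> n \<bullet> (W - U) > 0"

text \<open>Gram-Schmidt: \<open>m\<close> is the part of \<open>W - U\<close> orthogonal to
  \<open>V - U\<close>, nonzero because the points are not collinear.\<close>

lemma inward_normal_exists:
  assumes "\<not> collinear {U, V, W}"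
  shows "\<exists>n. inward_normal n U V W"
proof -
  let ?e = "V - U" and ?w = "W - U"
  define m where "m = ?w - ((?w \<bullet> ?e) / (?e \<bullet> ?e)) *\<^sub>R ?e"
  have "U \<noteq> V"
    using assms by auto
  have "m \<noteq> 0"
  proof
    assume "m = 0"
    then have "W = U + ((?w \<bullet> ?e) / (?e \<bullet> ?e)) *\<^sub>R ?e"
      by (simp add: m_def algebra_simps)
    then have "W \<in> affine hull {U, V}"
      unfolding affine_hull_2_alt by blast
    then show False
      using assms affine_hull_3_imp_collinear by blast
  qed
  have "?e \<bullet> ?e \<noteq> 0"
    using \<open>U \<noteq> V\<close> by simp
  then have me: "m \<bullet> ?e = 0"
    unfolding m_def inner_diff_left[of ?w] inner_scaleR_left by simp
  have "m \<bullet> ?w = m \<bullet> m + ((?w \<bullet> ?e) / (?e \<bullet> ?e)) * (m \<bullet> ?e)"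
    by (subst (3) m_def) (simp add: inner_diff_right)
  then have "m \<bullet> ?w > 0"
    using me \<open>m \<noteq> 0\<close> by simp
  then have "inward_normal (sgn m) U V W"
    using \<open>U \<noteq> V\<close> \<open>m \<noteq> 0\<close> me by (simp add: inward_normal_def norm_sgn sgn_div_norm)
  then show ?thesis ..
qed

lemma inward_normal_flip: "inward_normal n U V W \<Longrightarrow> inward_normal n V U W"
  by (auto simp: inward_normal_def inner_diff_right)

text \<open>For \<open>e \<noteq> 0\<close>, \<open>n\<close> and the normalised \<open>e\<close>
  form an orthonormal basis of the plane; this is Parseval's identity, multiplied by
  \<open>e \<bullet> e\<close> to avoid a division.\<close>

lemma inner_decomp_plane:
  fixes n e x y :: "real ^ 2"
  assumes "norm n = 1" "n \<bullet> e = 0"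
  shows "(e \<bullet> e) * (x \<bullet> y) = (e \<bullet> e) * ((n \<bullet> x) * (n \<bullet> y)) + (e \<bullet> x) * (e \<bullet> y)"
proof -
  \<comment> \<open>\<open>k\<close> is the signed length of \<open>e\<close> along \<open>n\<close>
    turned by a quarter turn.\<close>
  define k where "k = n $ 1 * e $ 2 - n $ 2 * e $ 1"
  have n: "n $ 1 * n $ 1 + n $ 2 * n $ 2 = 1"
    using assms(1) by (simp add: norm_eq_1 inner_vec_def sum_2)
  have o: "n $ 1 * e $ 1 + n $ 2 * e $ 2 = 0"
    using assms(2) by (simp add: inner_vec_def sum_2)
  have e1: "e $ 1 = - k * n $ 2"
    using n o unfolding k_def by algebra
  have e2: "e $ 2 = k * n $ 1"
    using n o unfolding k_def by algebra
  show ?thesis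
    unfolding inner_vec_def sum_2 inner_real_def e1 e2 using n by algebra
qed

lemma eq_0_plane:
  fixes n e x :: "real ^ 2"
  assumes "norm n = 1" "n \<bullet> e = 0" "e \<noteq> 0" "n \<bullet> x = 0" "e \<bullet> x = 0"
  shows "x = 0"
  using inner_decomp_plane[OF assms(1,2), of x x] assms(3-5) by simp

text \<open>Hesse normal form. For the converse inclusion, \<open>x - U\<close> minus its projection
  onto \<open>V - U\<close> is orthogonal to both \<open>n\<close> and \<open>V - U\<close>, hence
  zero.\<close>

lemma line_through_eq:
  assumes "inward_normal n U V W"
  shows "line_through U V = {x. n \<bullet> (x - U) = 0}"
proof (intro set_eqI iffI)
  fix x
  assume "x \<in> line_through U V"
  then show "x \<in> {x. n \<bullet> (x - U) = 0}"
    using assms by (auto simp: line_through_def affine_hull_2_alt inward_normal_def)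
next
  fix x
  assume x: "x \<in> {x. n \<bullet> (x - U) = 0}"
  let ?e = "V - U"
  have e: "norm n = 1" "n \<bullet> ?e = 0" "?e \<noteq> 0"
    using assms by (auto simp: inward_normal_def)
  have "x - U - ((?e \<bullet> (x - U)) / (?e \<bullet> ?e)) *\<^sub>R ?e = 0"
    using e x by (intro eq_0_plane[OF e]) (simp_all add: inner_diff_right[of _ "x - U"])
  then have "x = U + ((?e \<bullet> (x - U)) / (?e \<bullet> ?e)) *\<^sub>R ?e"
    by (simp add: algebra_simps)
  then show "x \<in> line_through U V"
    unfolding line_through_def affine_hull_2_alt by blast
qed

text \<open>The foot of the perpendicular gives the upper bound, Cauchy-Schwarz against
  \<open>n\<close> the lower one.\<close>

lemma infdist_line_through:
  assumes "inward_normal n U V W"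
  shows "infdist P (line_through U V) = \<bar>n \<bullet> (P - U)\<bar>"
proof (rule antisym)
  have n: "norm n = 1"
    using assms by (simp add: inward_normal_def)
  have "P - (n \<bullet> (P - U)) *\<^sub>R n \<in> line_through U V"
    using n unfolding line_through_eq[OF assms] by (simp add: algebra_simps norm_eq_1)
  then have "infdist P (line_through U V) \<le> dist P (P - (n \<bullet> (P - U)) *\<^sub>R n)"
    by (rule infdist_le)
  then show "infdist P (line_through U V) \<le> \<bar>n \<bullet> (P - U)\<bar>"
    using n by (simp add: dist_norm)
  have "\<bar>n \<bullet> (P - U)\<bar> \<le> dist P x" if "x \<in> line_through U V" for x
  proof -
    have "n \<bullet> (P - U) = n \<bullet> (P - x)"
      using that unfolding line_through_eq[OF assms] by (simp add: inner_diff_right)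
    then show ?thesis
      using Cauchy_Schwarz_ineq2[of n "P - x"] n by (simp add: dist_norm)
  qed
  moreover have "line_through U V \<noteq> {}"
    by (simp add: line_through_def)
  ultimately show "\<bar>n \<bullet> (P - U)\<bar> \<le> infdist P (line_through U V)"
    by (simp add: infdist_notempty cINF_greatest)
qed

text \<open>Uniqueness is the point: a vector orthogonal to the line is a multiple of
  \<open>n\<close>, and its length and the side of \<open>P\<close> fix the factor to 1.\<close>

lemma line_normal_eq:
  assumes n: "inward_normal n U V W" and "n \<bullet> (P - U) > 0"
  shows "line_normal P (line_through U V) = n"
  unfolding line_normal_def
proof (rule the_equality)
  show "norm n = 1 \<and> (\<forall>x\<in>line_through U V. \<forall>y\<in>line_through U V. n \<bullet> (x - y) = 0) \<and>
      (\<forall>x\<in>line_through U V. 0 < n \<bullet> (P - x))"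
    using assms unfolding line_through_eq[OF n] by (auto simp: inward_normal_def inner_diff_right)
next
  fix m
  assume m: "norm m = 1 \<and> (\<forall>x\<in>line_through U V. \<forall>y\<in>line_through U V. m \<bullet> (x - y) = 0) \<and>
      (\<forall>x\<in>line_through U V. 0 < m \<bullet> (P - x))"
  let ?e = "V - U"
  have e: "norm n = 1" "n \<bullet> ?e = 0" "?e \<noteq> 0"
    using n by (auto simp: inward_normal_def)
  have U: "U \<in> line_through U V" "V \<in> line_through U V"
    by (simp_all add: line_through_def hull_inc)
  then have me: "m \<bullet> ?e = 0" and mP: "m \<bullet> (P - U) > 0"
    using m by auto
  have "m - (n \<bullet> m) *\<^sub>R n = 0"
    using e me
    by (intro eq_0_plane[OF e]) (simp_all add: inner_diff_right[of _ m] norm_eq_1 inner_commute[of "V - U"])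
  then have mn: "m = (n \<bullet> m) *\<^sub>R n"
    by simp
  then have "(n \<bullet> m) * (n \<bullet> (P - U)) > 0"
    using mP by (metis inner_scaleR_left)
  then have "n \<bullet> m > 0"
    using assms(2) by (simp add: zero_less_mult_iff)
  moreover have "\<bar>n \<bullet> m\<bar> = 1"
    using mn m e(1) by (metis mult.right_neutral norm_scaleR)
  ultimately show "m = n"
    using mn by simp
qed

section \<open>What containment and tangency say about centers and radii\<close>

lemma inner_nonneg_of_convex_hull:
  assumes n: "inward_normal n U V W" and x: "x \<in> convex hull {U, V, W}"
  shows "0 \<le> n \<bullet> (x - U)"
proof -
  obtain u v where "0 \<le> v" and xu: "x = U + u *\<^sub>R (V - U) + v *\<^sub>R (W - U)"
    using x unfolding convex_hull_3_alt by blast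
  have "n \<bullet> (x - U) = u * (n \<bullet> (V - U)) + v * (n \<bullet> (W - U))"
    unfolding xu by (simp add: inner_add_right)
  then show ?thesis
    using n \<open>0 \<le> v\<close> by (simp add: inward_normal_def)
qed

text \<open>The point \<open>P - r *\<^sub>R n\<close> of the circle nearest to the side, or
  farthest beyond it, still lies in the triangle.\<close>

lemma radius_le_of_sphere_subset_hull:
  assumes n: "inward_normal n U V W" and "0 < r" and "sphere P r \<subseteq> convex hull {U, V, W}"
  shows "r \<le> n \<bullet> (P - U)"
proof -
  have "norm n = 1"
    using n by (simp add: inward_normal_def)
  then have "P - r *\<^sub>R n \<in> sphere P r"
    using \<open>0 < r\<close> by (simp add: dist_norm)
  then have "0 \<le> n \<bullet> (P - r *\<^sub>R n - U)"
    using assms inner_nonneg_of_convex_hull by blast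
  then show ?thesis
    using \<open>norm n = 1\<close> by (simp add: inner_diff_right norm_eq_1)
qed

text \<open>A single intersection point must be the foot of the perpendicular from \<open>P\<close>,
  so the radius is the distance to the line. Since the foot lies on the segment, \<open>P\<close>
  projects onto the ray from \<open>U\<close> through \<open>V\<close>.\<close>

lemma tangent_to_sideD:
  assumes n: "inward_normal n U V W" and tangent: "tangent_to_side P r U V" and P: "0 \<le> n \<bullet> (P - U)"
  shows "n \<bullet> (P - U) = r" and "0 \<le> (V - U) \<bullet> (P - U)"
proof -
  let ?e = "V - U"
  have e: "norm n = 1" "n \<bullet> ?e = 0" "?e \<noteq> 0"
    using n by (auto simp: inward_normal_def)
  obtain t where t: "t \<in> closed_segment U V" and st: "sphere P r \<inter> line_through U V = {t}"
    using tangent by (auto simp: tangent_to_side_def)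
  have tr: "norm (t - P) = r" and tl: "n \<bullet> (t - U) = 0"
    using st unfolding line_through_eq[OF n] by (auto simp: dist_norm norm_minus_commute)
  \<comment> \<open>The reflection of \<open>t\<close> in the perpendicular from \<open>P\<close> lies in the same intersection.\<close>
  define c where "c = 2 * (?e \<bullet> (t - P)) / (?e \<bullet> ?e)"
  have "(t - c *\<^sub>R ?e - P) \<bullet> (t - c *\<^sub>R ?e - P)
      = (t - P) \<bullet> (t - P) - 2 * c * (?e \<bullet> (t - P)) + c * (c * (?e \<bullet> ?e))"
  proof -
    have "t - c *\<^sub>R ?e - P = (t - P) - c *\<^sub>R ?e"
      by simp
    then show ?thesis
      by (simp only:) (simp add: inner_diff_left[of "t - P"] inner_diff_right[of _ "t - P"] inner_commute algebra_simps)
  qed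
  also have "c * (?e \<bullet> ?e) = 2 * (?e \<bullet> (t - P))"
    using e(3) by (simp add: c_def)
  finally have "norm (t - c *\<^sub>R ?e - P) = norm (t - P)"
    by (simp add: norm_eq)
  then have "t - c *\<^sub>R ?e \<in> sphere P r \<inter> line_through U V"
    using tr tl e(2) unfolding line_through_eq[OF n] by (simp add: dist_norm norm_minus_commute inner_diff_right)
  then have "c = 0"
    using st e(3) by auto
  then have te: "?e \<bullet> (t - P) = 0"
    using e(3) by (simp add: c_def)
  have "(?e \<bullet> ?e) * ((t - P) \<bullet> (t - P)) = (?e \<bullet> ?e) * (n \<bullet> (t - P))\<^sup>2"
    using inner_decomp_plane[OF e(1,2), of "t - P" "t - P"] te by (simp add: power2_eq_square)
  then have "r\<^sup>2 = (n \<bullet> (P - U))\<^sup>2"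
    using e(3) tr tl by (simp add: dot_square_norm inner_diff_right power2_commute)
  moreover have "0 \<le> r"
    using tr by auto
  ultimately show "n \<bullet> (P - U) = r"
    using P by (simp add: power2_eq_iff_nonneg)
  obtain u where "0 \<le> u" "t = (1 - u) *\<^sub>R U + u *\<^sub>R V"
    using t by (auto simp: closed_segment_def)
  then have "t - U = u *\<^sub>R ?e"
    by (simp add: algebra_simps)
  then have "?e \<bullet> (t - U) = u * (?e \<bullet> ?e)"
    by simp
  moreover have "?e \<bullet> (P - U) = ?e \<bullet> (t - U)"
    using te by (simp add: inner_diff_right)
  ultimately show "0 \<le> ?e \<bullet> (P - U)"
    using \<open>0 \<le> u\<close> by simp
qed

text \<open>A common point bounds the distance from above. Were the distance smaller, the point
  dividing the segment from \<open>P\<close> to \<open>Q\<close> in the ratio \<open>r\<close> to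
  \<open>s\<close> would lie in both open discs.\<close>

lemma externally_tangentD:
  assumes "externally_tangent P r Q s" "0 < r" "0 < s"
  shows "norm (Q - P) = r + s"
proof (rule antisym)
  obtain t where "dist P t = r" "dist Q t = s"
    using assms(1) unfolding externally_tangent_def by (metis IntD1 IntD2 insertI1 mem_sphere)
  then show "norm (Q - P) \<le> r + s"
    using dist_triangle2[of P Q t] by (simp add: dist_norm norm_minus_commute)
  show "r + s \<le> norm (Q - P)"
  proof (rule ccontr)
    assume "\<not> r + s \<le> norm (Q - P)"
    then have less: "norm (Q - P) < r + s"
      by simp
    define x where "x = P + (r / (r + s)) *\<^sub>R (Q - P)"
    have "Q - x = (s / (r + s)) *\<^sub>R (Q - P)"
    proof -
      have "Q - x = (1 - r / (r + s)) *\<^sub>R (Q - P)"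
        by (simp add: x_def algebra_simps)
      also have "1 - r / (r + s) = s / (r + s)"
        using assms(2,3) by (simp add: field_simps)
      finally show ?thesis .
    qed
    then have "dist Q x = s * (norm (Q - P) / (r + s))"
      using assms(2,3) by (simp add: dist_norm)
    moreover have "dist P x = r * (norm (Q - P) / (r + s))"
      using assms(2,3) by (simp add: dist_norm x_def)
    moreover have "norm (Q - P) / (r + s) < 1"
      using less assms(2,3) by simp
    then have "r * (norm (Q - P) / (r + s)) < r" "s * (norm (Q - P) / (r + s)) < s"
      using assms(2,3) by (simp_all only: mult_less_cancel_left2 mult_less_cancel_left1) auto
    ultimately have "x \<in> ball P r \<inter> ball Q s"
      by simp
    then show False
      using assms(1) by (auto simp: externally_tangent_def)
  qed
qed

text \<open>
  The circle inscribed in the angle at \<open>U\<close> comes first along the side \<open>U V\<close>, since it stays on the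
  near side of \<open>V W\<close> while the other circle stays on the near side of \<open>U W\<close>.
\<close>

lemma centers_ordered:
  assumes n: "inward_normal n U V W" and m: "inward_normal m U W V" and k: "inward_normal k V W U"
    and P: "n \<bullet> (P - U) = r" "m \<bullet> (P - U) = r" "r \<le> k \<bullet> (P - V)"
    and Q: "n \<bullet> (Q - U) = s" "k \<bullet> (Q - V) = s" "s \<le> m \<bullet> (Q - U)"
  shows "0 \<le> (V - U) \<bullet> (Q - P)"
proof (rule ccontr)
  let ?e = "V - U" and ?w = "Q - P"
  assume "\<not> 0 \<le> ?e \<bullet> ?w"
  then have neg: "?e \<bullet> ?w < 0"
    by simp
  have e: "norm n = 1" "n \<bullet> ?e = 0" "?e \<noteq> 0"
    using n by (auto simp: inward_normal_def)
  then have ee: "?e \<bullet> ?e > 0"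
    by simp
  have nw: "n \<bullet> ?w = s - r"
    using P(1) Q(1) by (simp add: inner_diff_right)
  have mw: "n \<bullet> ?w \<le> m \<bullet> ?w" and kw: "k \<bullet> ?w \<le> n \<bullet> ?w"
    unfolding nw using P Q by (simp_all add: inner_diff_right)
  have em: "?e \<bullet> m > 0" and ek: "?e \<bullet> k < 0"
    using m k by (simp_all add: inward_normal_def inner_diff_left inner_diff_right inner_commute)
  have nm: "n \<bullet> m \<le> 1" and nk: "n \<bullet> k \<le> 1"
    using norm_cauchy_schwarz[of n m] norm_cauchy_schwarz[of n k] n m k by (simp_all add: inward_normal_def)
  \<comment> \<open>Decomposing \<open>m\<close> along \<open>n\<close> and the side turns the
    comparison with \<open>m\<close> into \<open>s < r\<close>; the same computation with
    \<open>k\<close>, whose component along the side has the opposite sign, gives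
    \<open>r < s\<close>.\<close>
  have "(?e \<bullet> ?e) * ((1 - n \<bullet> m) * (n \<bullet> ?w)) \<le> (?e \<bullet> m) * (?e \<bullet> ?w)"
    using inner_decomp_plane[OF e(1,2), of m ?w] mult_left_mono[OF mw, of "?e \<bullet> ?e"] ee
    by (simp add: algebra_simps)
  also have "\<dots> < 0"
    using em neg by (simp add: mult_pos_neg)
  finally have "(1 - n \<bullet> m) * (n \<bullet> ?w) < 0"
    using ee by (simp add: mult_less_0_iff)
  then have "n \<bullet> ?w < 0"
    using nm by (simp add: mult_less_0_iff)
  have "0 < (?e \<bullet> k) * (?e \<bullet> ?w)"
    using ek neg by (simp add: mult_neg_neg)
  also have "\<dots> \<le> (?e \<bullet> ?e) * ((1 - n \<bullet> k) * (n \<bullet> ?w))"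
    using inner_decomp_plane[OF e(1,2), of k ?w] mult_left_mono[OF kw, of "?e \<bullet> ?e"] ee
    by (simp add: algebra_simps)
  finally have "0 < (1 - n \<bullet> k) * (n \<bullet> ?w)"
    using ee zero_less_mult_pos by blast
  then have "0 < n \<bullet> ?w"
    using nk by (simp add: zero_less_mult_iff)
  with \<open>n \<bullet> ?w < 0\<close> show False
    by simp
qed

section \<open>Infinitesimal motions that preserve the contacts\<close>

text \<open>The difference of the two sides is the coefficient of the growth rate of the circle at
  \<open>U\<close> in the linearised tangency condition. The normal parts of \<open>Q - P\<close>
  and \<open>P - U\<close> contribute \<open>(s - r) * r\<close> to their inner product, and the
  parts along the side contribute a nonnegative amount.\<close>

lemma vertex_coefficient_neg:
  assumes n: "inward_normal n U V W" and r: "n \<bullet> (P - U) = r" "n \<bullet> (Q - U) = s" "0 < r" "0 < s"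
    and "0 \<le> (V - U) \<bullet> (P - U)" and "0 \<le> (V - U) \<bullet> (Q - P)"
  shows "(Q - P) \<bullet> (U - P) < r * (r + s)"
proof -
  let ?e = "V - U"
  have e: "norm n = 1" "n \<bullet> ?e = 0" "?e \<noteq> 0"
    using n by (auto simp: inward_normal_def)
  have "n \<bullet> (Q - P) = s - r"
    using r by (simp add: inner_diff_right)
  then have "(?e \<bullet> ?e) * ((Q - P) \<bullet> (P - U)) = (?e \<bullet> ?e) * ((s - r) * r) + (?e \<bullet> (Q - P)) * (?e \<bullet> (P - U))"
    using inner_decomp_plane[OF e(1,2), of "Q - P" "P - U"] r by simp
  then have "(?e \<bullet> ?e) * ((s - r) * r) \<le> (?e \<bullet> ?e) * ((Q - P) \<bullet> (P - U))"
    using assms(6,7) by simp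
  then have "(s - r) * r \<le> (Q - P) \<bullet> (P - U)"
    using e(3) by simp
  then have "(Q - P) \<bullet> (U - P) \<le> r * r - r * s"
    by (simp add: algebra_simps inner_diff_right)
  also have "\<dots> < r * (r + s)"
    using \<open>0 < r\<close> \<open>0 < s\<close> by (simp add: algebra_simps add_pos_pos)
  finally show ?thesis .
qed

text \<open>The metric content of containment and tangency for the circle in the angle at
  \<open>U\<close>, written with inner products only. The arguments allow every pair of a circle and
  an adjacent side to be treated by permuting vertices and normals.\<close>

definition angle_circle ::
    "real ^ 2 \<Rightarrow> real ^ 2 \<Rightarrow> real ^ 2 \<Rightarrow> real ^ 2 \<Rightarrow> real ^ 2 \<Rightarrow> real ^ 2 \<Rightarrow> real ^ 2 \<Rightarrow> real \<Rightarrow> bool" where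
  "angle_circle n m k U V W P r \<longleftrightarrow>
    inward_normal n U V W \<and> inward_normal m U W V \<and> inward_normal k V W U \<and> 0 < r \<and>
    n \<bullet> (P - U) = r \<and> m \<bullet> (P - U) = r \<and> r \<le> k \<bullet> (P - V) \<and>
    0 \<le> (V - U) \<bullet> (P - U) \<and> 0 \<le> (W - U) \<bullet> (P - U)"

lemma inward_normal_base: "inward_normal n U V W \<Longrightarrow> n \<bullet> (x - V) = n \<bullet> (x - U)"
  by (simp add: inward_normal_def inner_diff_right)

lemma angle_circle_swap:
  assumes "angle_circle n m k U V W P r"
  shows "angle_circle m n k U W V P r"
  using assms inward_normal_base[of k V W U P] inward_normal_flip[of k V W U]
  by (simp add: angle_circle_def)

lemma angle_circleI:
  assumes n: "inward_normal n U V W" "inward_normal m U W V" "inward_normal k V W U"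
    and "0 < r" and hull: "sphere P r \<subseteq> convex hull {U, V, W}"
    and "tangent_to_side P r U V" "tangent_to_side P r U W"
  shows "angle_circle n m k U V W P r"
proof -
  have hull': "sphere P r \<subseteq> convex hull {U, W, V}" "sphere P r \<subseteq> convex hull {V, W, U}"
    using hull by (simp_all add: insert_commute)
  have ge: "r \<le> n \<bullet> (P - U)" "r \<le> m \<bullet> (P - U)" "r \<le> k \<bullet> (P - V)"
    using n \<open>0 < r\<close> hull hull' by (blast intro: radius_le_of_sphere_subset_hull)+
  have "0 \<le> n \<bullet> (P - U)" "0 \<le> m \<bullet> (P - U)"
    using ge \<open>0 < r\<close> by simp_all
  then show ?thesis
    using n ge \<open>0 < r\<close> tangent_to_sideD[OF n(1) assms(6)] tangent_to_sideD[OF n(2) assms(7)]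
    by (simp add: angle_circle_def)
qed

text \<open>The normals of the two sides at \<open>U\<close> are independent, so the two equations
  have one solution, and a multiple of \<open>P - U\<close> is one. Thus the circle undergoes an
  infinitesimal homothety about \<open>U\<close>.\<close>

lemma kernel_at_vertex:
  assumes P: "angle_circle n m k U V W P r" and p: "n \<bullet> p = s" "m \<bullet> p = s"
  shows "p = (s / r) *\<^sub>R (P - U)"
proof -
  let ?e = "V - U"
  have e: "norm n = 1" "n \<bullet> ?e = 0" "?e \<noteq> 0" and em: "?e \<bullet> m > 0"
    and r: "0 < r" "n \<bullet> (P - U) = r" "m \<bullet> (P - U) = r"
    using P by (auto simp: angle_circle_def inward_normal_def inner_commute)
  define x where "x = p - (s / r) *\<^sub>R (P - U)"
  have "n \<bullet> x = 0" "m \<bullet> x = 0"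
    unfolding x_def inner_diff_right[of _ p] inner_scaleR_right p r(2,3) using r(1) by simp_all
  moreover have "?e \<bullet> x = 0"
    using inner_decomp_plane[OF e(1,2), of m x] calculation em by simp
  ultimately have "x = 0"
    using eq_0_plane[OF e] by blast
  then show ?thesis
    by (simp add: x_def)
qed

text \<open>
  An infinitesimal motion keeping the contacts with the sides scales each circle about its vertex;
  keeping two circles tangent forces one to grow while the other shrinks.
\<close>

lemma opposite_scaling:
  assumes P: "angle_circle n m k U V W P r" and Q: "angle_circle n k m V U W Q s"
    and d: "norm (Q - P) = r + s"
    and h: "sgn (Q - P) \<bullet> (b *\<^sub>R (Q - V) - a *\<^sub>R (P - U)) = a * r + b * s"
  shows "0 < a \<longleftrightarrow> b < 0" "a < 0 \<longleftrightarrow> 0 < b"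
proof -
  have n: "inward_normal n U V W" "inward_normal n V U W"
    and m: "inward_normal m U W V" and k: "inward_normal k V W U"
    and r: "0 < r" "n \<bullet> (P - U) = r" "m \<bullet> (P - U) = r" "r \<le> k \<bullet> (P - V)" "0 \<le> (V - U) \<bullet> (P - U)"
    and s: "0 < s" "n \<bullet> (Q - V) = s" "k \<bullet> (Q - V) = s" "s \<le> m \<bullet> (Q - U)" "0 \<le> (U - V) \<bullet> (Q - V)"
    using P Q by (auto simp: angle_circle_def)
  have base: "n \<bullet> (Q - U) = s" "n \<bullet> (P - V) = r"
    using r s inward_normal_base[OF n(1)] by simp_all
  have le: "0 \<le> (V - U) \<bullet> (Q - P)"
    by (rule centers_ordered[OF n(1) m k r(2-4) base(1) s(3,4)])
  then have le': "0 \<le> (U - V) \<bullet> (P - Q)"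
    by (metis inner_minus_left inner_minus_right minus_diff_eq minus_minus)
  \<comment> \<open>Multiplied by \<open>r + s\<close>, the tangency condition reads
    \<open>a * x + b * y = 0\<close>; both coefficients turn out negative, so \<open>a\<close> and
    \<open>b\<close> have opposite signs or both vanish.\<close>
  define x where "x = (Q - P) \<bullet> (U - P) - r * (r + s)"
  define y where "y = (P - Q) \<bullet> (V - Q) - s * (s + r)"
  have x: "x < 0"
    using vertex_coefficient_neg[OF n(1) r(2) base(1) r(1) s(1) r(5) le] by (simp add: x_def)
  have y: "y < 0"
    using vertex_coefficient_neg[OF n(2) s(2) base(2) s(1) r(1) s(5) le'] by (simp add: y_def)
  have "(Q - P) \<bullet> (b *\<^sub>R (Q - V) - a *\<^sub>R (P - U)) = (r + s) * (a * r + b * s)"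
  proof -
    have "Q - P = (r + s) *\<^sub>R sgn (Q - P)"
      using d r s by (simp add: sgn_div_norm)
    then show ?thesis
      using h by (metis inner_scaleR_left)
  qed
  moreover have "(Q - P) \<bullet> (b *\<^sub>R (Q - V) - a *\<^sub>R (P - U))
      = b * ((P - Q) \<bullet> (V - Q)) + a * ((Q - P) \<bullet> (U - P))"
    by (simp add: inner_diff_left inner_diff_right algebra_simps)
  ultimately have eq: "a * x + b * y = 0"
    by (simp add: x_def y_def algebra_simps)
  show "0 < a \<longleftrightarrow> b < 0" "a < 0 \<longleftrightarrow> 0 < b"
    using eq x y
    by (smt (verit) mult_pos_neg mult_neg_neg mult_less_0_iff zero_less_mult_iff)+
qed

lemma line_through_commute: "line_through U V = line_through V U"
  by (simp add: line_through_def insert_commute)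

lemma tangent_to_side_commute: "tangent_to_side P r U V \<longleftrightarrow> tangent_to_side P r V U"
  by (simp add: tangent_to_side_def line_through_commute closed_segment_commute)

section \<open>The state space and the modules\<close>

lemma exhaust_9:
  fixes x :: 9
  shows "x = 1 \<or> x = 2 \<or> x = 3 \<or> x = 4 \<or> x = 5 \<or> x = 6 \<or> x = 7 \<or> x = 8 \<or> x = 9"
proof (induct x)
  case (of_int z)
  \<comment> \<open>The representatives run from 0 to 8; in this type the numeral \<open>9\<close>
    is 0.\<close>
  then have "z = 0 \<or> z = 1 \<or> z = 2 \<or> z = 3 \<or> z = 4 \<or> z = 5 \<or> z = 6 \<or> z = 7 \<or> z = 8"
    by (simp, presburger)
  then show ?case
    by auto
qed

lemma forall_9: "(\<forall>i::9. P i) \<longleftrightarrow> P 1 \<and> P 2 \<and> P 3 \<and> P 4 \<and> P 5 \<and> P 6 \<and> P 7 \<and> P 8 \<and> P 9"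
  by (metis exhaust_9)

lemma UNIV_9: "UNIV = {1, 2, 3, 4, 5, 6, 7, 8, 9::9}"
  using exhaust_9 by auto

lemma sum_9: "sum f (UNIV::9 set) = f 1 + f 2 + f 3 + f 4 + f 5 + f 6 + f 7 + f 8 + f 9"
  unfolding UNIV_9 by (simp add: ac_simps)

lemma vector_9 [simp]:
  fixes a b c d e f g h i :: "'a::zero"
  shows "(vector [a, b, c, d, e, f, g, h, i] :: 'a ^ 9) $ 1 = a"
    "(vector [a, b, c, d, e, f, g, h, i] :: 'a ^ 9) $ 2 = b"
    "(vector [a, b, c, d, e, f, g, h, i] :: 'a ^ 9) $ 3 = c"
    "(vector [a, b, c, d, e, f, g, h, i] :: 'a ^ 9) $ 4 = d"
    "(vector [a, b, c, d, e, f, g, h, i] :: 'a ^ 9) $ 5 = e"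
    "(vector [a, b, c, d, e, f, g, h, i] :: 'a ^ 9) $ 6 = f"
    "(vector [a, b, c, d, e, f, g, h, i] :: 'a ^ 9) $ 7 = g"
    "(vector [a, b, c, d, e, f, g, h, i] :: 'a ^ 9) $ 8 = h"
    "(vector [a, b, c, d, e, f, g, h, i] :: 'a ^ 9) $ 9 = i"
  unfolding vector_def by simp_all

lemma state_eqI:
  assumes "\<And>i. center X i = center Y i" "\<And>i. radius X i = radius Y i"
  shows "X = Y"
  using assms(1)[of 1] assms(1)[of 2] assms(1)[of 3] assms(2)[of 1] assms(2)[of 2] assms(2)[of 3]
  by (simp add: center_def radius_def vec_eq_iff forall_9 forall_2)

lemma center_add [simp]: "center (X + Y) i = center X i + center Y i"
  and center_scaleR [simp]: "center (c *\<^sub>R X) i = c *\<^sub>R center X i"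
  and center_minus [simp]: "center (- X) i = - center X i"
  and center_diff [simp]: "center (X - Y) i = center X i - center Y i"
  and center_0 [simp]: "center 0 i = 0"
  by (simp_all add: center_def vec_eq_iff forall_2)

lemma radius_add [simp]: "radius (X + Y) i = radius X i + radius Y i"
  and radius_scaleR [simp]: "radius (c *\<^sub>R X) i = c * radius X i"
  and radius_minus [simp]: "radius (- X) i = - radius X i"
  and radius_diff [simp]: "radius (X - Y) i = radius X i - radius Y i"
  and radius_0 [simp]: "radius 0 i = 0"
  by (simp_all add: radius_def)

lemma bounded_linear_center: "bounded_linear (\<lambda>X. center X i)"
  unfolding linear_conv_bounded_linear[symmetric] by (rule linearI) simp_all

lemma bounded_linear_radius: "bounded_linear (\<lambda>X. radius X i)"
  unfolding linear_conv_bounded_linear[symmetric] by (rule linearI) simp_all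

lemma continuous_on_center: "continuous_on S (\<lambda>X. center X i)"
  by (rule linear_continuous_on[OF bounded_linear_center])

lemma center_circle_block [simp]: "center (circle_block i p s) j = (if j = i then p else 0)"
  using exhaust_3[of i] exhaust_3[of j]
  by (auto simp: center_def circle_block_def vec_eq_iff forall_2)

lemma radius_circle_block [simp]: "radius (circle_block i p s) j = (if j = i then s else 0)"
  using exhaust_3[of i] exhaust_3[of j] by (auto simp: radius_def circle_block_def)

lemma inner_circle_block: "circle_block i p s \<bullet> X = p \<bullet> center X i + s * radius X i"
  using exhaust_3[of i]
  by (auto simp: inner_vec_def sum_9 sum_2 center_def radius_def circle_block_def)

lemma inner_self_state:
  "X \<bullet> X = (center X 1 \<bullet> center X 1 + (radius X 1)\<^sup>2) + (center X 2 \<bullet> center X 2 + (radius X 2)\<^sup>2)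
    + (center X 3 \<bullet> center X 3 + (radius X 3)\<^sup>2)"
  by (simp add: inner_vec_def sum_9 sum_2 center_def radius_def power2_eq_square)

section \<open>Derivatives of the contact errors and of the modules\<close>

lemma gradient_eqI:
  assumes "GDERIV f x :> D"
  shows "gradient f x = D"
  unfolding gradient_def
proof (rule the_equality)
  show "GDERIV f x :> D"
    by (rule assms)
next
  fix D'
  assume "GDERIV f x :> D'"
  then have "(\<lambda>h. h \<bullet> D') = (\<lambda>h. h \<bullet> D)"
    using assms unfolding gderiv_def by (rule has_derivative_unique)
  then have "\<forall>h. h \<bullet> D' = h \<bullet> D"
    by (simp add: fun_eq_iff)
  then show "D' = D"
    by (simp only: vector_eq_ldot)
qed

text \<open>Product rule at a zero of the scalar factor: the term with the derivative of
  \<open>G\<close> is multiplied by \<open>c x = 0\<close>, so continuity of \<open>G\<close>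
  suffices.\<close>

lemma has_derivative_scaleR_zero:
  fixes c :: "'a::real_normed_vector \<Rightarrow> real" and G :: "'a \<Rightarrow> 'b::real_normed_vector"
  assumes c: "(c has_derivative c') (at x)" "c x = 0" and G: "isCont G x"
  shows "((\<lambda>y. c y *\<^sub>R G y) has_derivative (\<lambda>v. c' v *\<^sub>R G x)) (at x)"
proof -
  have bl: "bounded_linear c'"
    using c(1) by (rule has_derivative_bounded_linear)
  obtain K where K: "\<And>v. norm (c' v) \<le> norm v * K"
    using bounded_linear.bounded[OF bl] by blast
  define E where "E = (\<lambda>y. norm (c y - c x - c' (y - x)) / norm (y - x))"
  have E: "(E \<longlongrightarrow> 0) (at x)"
    using c(1) unfolding E_def has_derivative_iff_norm by blast
  have lim: "((\<lambda>y. E y * norm (G y) + K * norm (G y - G x)) \<longlongrightarrow> 0 * norm (G x) + K * norm (G x - G x)) (at x)"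
    by (intro tendsto_add tendsto_mult tendsto_norm tendsto_diff tendsto_const E G[unfolded isCont_def])
  have bound: "norm (norm (c y *\<^sub>R G y - c x *\<^sub>R G x - c' (y - x) *\<^sub>R G x) / norm (y - x))
      \<le> E y * norm (G y) + K * norm (G y - G x)" if "y \<noteq> x" for y
  proof -
    \<comment> \<open>The first summand is the remainder of \<open>c\<close>, the second is small by
      continuity of \<open>G\<close>.\<close>
    have "c y *\<^sub>R G y - c x *\<^sub>R G x - c' (y - x) *\<^sub>R G x
        = (c y - c x - c' (y - x)) *\<^sub>R G y + c' (y - x) *\<^sub>R (G y - G x)"
      unfolding c(2) by (simp add: scaleR_diff_left scaleR_diff_right)
    then have "norm (c y *\<^sub>R G y - c x *\<^sub>R G x - c' (y - x) *\<^sub>R G x)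
        \<le> norm (c y - c x - c' (y - x)) * norm (G y) + norm (c' (y - x)) * norm (G y - G x)"
      using norm_triangle_ineq[of "(c y - c x - c' (y - x)) *\<^sub>R G y" "c' (y - x) *\<^sub>R (G y - G x)"]
      by (simp only: norm_scaleR real_norm_def)
    also have "\<dots> \<le> norm (c y - c x - c' (y - x)) * norm (G y) + (norm (y - x) * K) * norm (G y - G x)"
      by (intro add_left_mono mult_right_mono K) simp
    also have "\<dots> = (E y * norm (G y) + K * norm (G y - G x)) * norm (y - x)"
    proof -
      have "norm (c y - c x - c' (y - x)) = E y * norm (y - x)"
        using that by (simp add: E_def)
      then show ?thesis
        by (simp only: distrib_left distrib_right mult_ac)
    qed
    finally show ?thesis
      using that by (simp add: divide_le_eq del: scaleR_right_diff_distrib)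
  qed
  show ?thesis
    unfolding has_derivative_iff_norm
  proof
    show "bounded_linear (\<lambda>v. c' v *\<^sub>R G x)"
      by (intro bounded_linear_scaleR_const bl)
    show "((\<lambda>y. norm (c y *\<^sub>R G y - c x *\<^sub>R G x - c' (y - x) *\<^sub>R G x) / norm (y - x)) \<longlongrightarrow> 0) (at x)"
    proof (rule Lim_null_comparison)
      show "\<forall>\<^sub>F y in at x. norm (norm (c y *\<^sub>R G y - c x *\<^sub>R G x - c' (y - x) *\<^sub>R G x) / norm (y - x))
          \<le> E y * norm (G y) + K * norm (G y - G x)"
        unfolding eventually_at_filter using bound by (intro always_eventually) blast
      show "((\<lambda>y. E y * norm (G y) + K * norm (G y - G x)) \<longlongrightarrow> 0) (at x)"
        using lim by (simp only: mult_zero_left diff_self norm_zero mult_zero_right add_0)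
    qed
  qed
qed

text \<open>Explicit gradients of the contact errors: \<open>n\<close> is to be the inward normal of
  the line, and \<open>u\<close> below the unit vector from center \<open>i\<close> to center
  \<open>j\<close>.\<close>

abbreviation line_gradient :: "3 \<Rightarrow> real ^ 2 \<Rightarrow> real ^ 9" where
  "line_gradient i n \<equiv> circle_block i (- n) 1"

abbreviation circle_gradient :: "3 \<Rightarrow> 3 \<Rightarrow> real ^ 2 \<Rightarrow> real ^ 9" where
  "circle_gradient i j u \<equiv> circle_block i (- u) (- 1) + circle_block j u (- 1)"

lemma open_inner_center_pos: "open {X. n \<bullet> (center X i - U) > 0}"
  by (intro open_Collect_less continuous_on_inner continuous_on_diff continuous_on_center continuous_on_const)

lemma line_error_eq:
  assumes "inward_normal n U V W" "n \<bullet> (center X i - U) > 0"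
  shows "line_error i (line_through U V) X = radius X i - n \<bullet> (center X i - U)"
  using assms by (simp add: line_error_def infdist_line_through)

text \<open>On the open set of states whose center \<open>i\<close> is on the inner side of the
  line, the distance is affine in the state.\<close>

lemma line_error_has_derivative:
  assumes n: "inward_normal n U V W" and X: "n \<bullet> (center X i - U) > 0"
  shows "(line_error i (line_through U V) has_derivative (\<lambda>v. v \<bullet> line_gradient i n)) (at X)"
proof (rule has_derivative_transform_within_open[OF _ open_inner_center_pos[of n i U]])
  have "((\<lambda>X. radius X i - n \<bullet> (center X i - U)) has_derivative
      (\<lambda>v. radius v i - n \<bullet> (center v i - 0))) (at X)"
    by (intro has_derivative_diff has_derivative_inner_right has_derivative_const
        bounded_linear_imp_has_derivative bounded_linear_center bounded_linear_radius)
  then show "((\<lambda>X. radius X i - n \<bullet> (center X i - U)) has_derivative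
      (\<lambda>v. v \<bullet> line_gradient i n)) (at X)"
    by (simp add: inner_commute[of _ "line_gradient i n"] inner_circle_block)
qed (use X line_error_eq[OF n] in simp_all)

text \<open>The correction is a gradient descent step for half the squared error, with step size
  \<open>(1 - q) / 2\<close>.\<close>

lemma lc_module_eq:
  assumes n: "inward_normal n U V W" and X: "n \<bullet> (center X i - U) > 0"
  shows "lc_module q i (line_through U V) X
    = (- ((1 - q) / 2) * line_error i (line_through U V) X) *\<^sub>R line_gradient i n"
  by (rule state_eqI) (simp_all add: lc_module_def line_normal_eq[OF assms] Let_def)

lemma lc_module_has_derivative:
  assumes n: "inward_normal n U V W" and X: "n \<bullet> (center X i - U) = radius X i" "radius X i > 0"
  shows "(lc_module q i (line_through U V) has_derivative
      (\<lambda>v. (- ((1 - q) / 2) * (v \<bullet> line_gradient i n)) *\<^sub>R line_gradient i n)) (at X)"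
proof (rule has_derivative_transform_within_open[OF _ open_inner_center_pos[of n i U]])
  show "((\<lambda>X. (- ((1 - q) / 2) * line_error i (line_through U V) X) *\<^sub>R line_gradient i n) has_derivative
      (\<lambda>v. (- ((1 - q) / 2) * (v \<bullet> line_gradient i n)) *\<^sub>R line_gradient i n)) (at X)"
    using X by (intro has_derivative_scaleR_left has_derivative_mult_right line_error_has_derivative[OF n]) simp
qed (use X lc_module_eq[OF n] in simp_all)

lemma circle_error_has_derivative:
  assumes "center X i \<noteq> center X j"
  shows "(circle_error i j has_derivative
      (\<lambda>v. v \<bullet> circle_gradient i j (sgn (center X j - center X i)))) (at X)"
proof -
  have "((\<lambda>X. norm (center X j - center X i)) has_derivative
      (\<lambda>v. (center v j - center v i) \<bullet> sgn (center X j - center X i))) (at X)"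
    using assms
    by (intro has_derivative_compose[OF _ has_derivative_norm, where f = "\<lambda>X. center X j - center X i"]
        has_derivative_diff bounded_linear_imp_has_derivative bounded_linear_center) simp
  then have "((\<lambda>X. norm (center X j - center X i) - radius X i - radius X j) has_derivative
      (\<lambda>v. (center v j - center v i) \<bullet> sgn (center X j - center X i) - radius v i - radius v j)) (at X)"
    by (intro has_derivative_diff bounded_linear_imp_has_derivative bounded_linear_radius)
  moreover have "(\<lambda>v. (center v j - center v i) \<bullet> sgn (center X j - center X i) - radius v i - radius v j)
      = (\<lambda>v. v \<bullet> circle_gradient i j (sgn (center X j - center X i)))"
    unfolding inner_commute[of _ "circle_gradient i j u" for u]
    by (simp add: inner_add_left inner_circle_block inner_commute[of "sgn w" for w] inner_diff_left)
      (simp add: algebra_simps)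
  ultimately show ?thesis
    unfolding circle_error_def by simp
qed

text \<open>Again a gradient step, now of size \<open>(1 - q) / 4\<close>. The identity also holds
  for coinciding centers, because \<open>sgn 0 = 0\<close> agrees with division by zero.\<close>

lemma cc_module_eq:
  "cc_module q i j X
    = (- ((1 - q) / 4) * circle_error i j X) *\<^sub>R circle_gradient i j (sgn (center X j - center X i))"
proof -
  have "(1 / norm w) *\<^sub>R w = sgn w" for w :: "real ^ 2"
    by (simp add: sgn_div_norm inverse_eq_divide)
  then show ?thesis
    by (intro state_eqI) (simp_all add: cc_module_def Let_def)
qed

lemma isCont_circle_block:
  assumes "isCont f x"
  shows "isCont (\<lambda>x. circle_block i (f x) s) x"
proof -
  \<comment> \<open>For \<open>s \<noteq> 0\<close> the block is only affine in \<open>p\<close>, so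
    its constant part is split off.\<close>
  have "bounded_linear (\<lambda>p. circle_block i p 0)"
    unfolding linear_conv_bounded_linear[symmetric] by (intro linearI state_eqI) simp_all
  then have "isCont (\<lambda>x. circle_block i (f x) 0 + circle_block i 0 s) x"
    by (intro continuous_add continuous_const bounded_linear.isCont[OF _ assms])
  moreover have "circle_block i p 0 + circle_block i 0 s = circle_block i p s" for p
    by (rule state_eqI) simp_all
  ultimately show ?thesis
    by simp
qed

text \<open>Unlike the normal of a line, the direction between the centers varies with the state;
  its variation drops out since the error vanishes at \<open>X\<close>.\<close>

lemma cc_module_has_derivative:
  assumes "center X i \<noteq> center X j" and "circle_error i j X = 0"
    and u: "u = sgn (center X j - center X i)"
  shows "(cc_module q i j has_derivative
      (\<lambda>v. (- ((1 - q) / 4) * (v \<bullet> circle_gradient i j u)) *\<^sub>R circle_gradient i j u)) (at X)"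
proof -
  let ?G = "\<lambda>X. circle_gradient i j (sgn (center X j - center X i))"
  have "((\<lambda>X. - ((1 - q) / 4) * circle_error i j X) has_derivative
      (\<lambda>v. - ((1 - q) / 4) * (v \<bullet> circle_gradient i j u))) (at X)"
    unfolding u by (rule has_derivative_mult_right[OF circle_error_has_derivative[OF assms(1)]])
  moreover have "- ((1 - q) / 4) * circle_error i j X = 0"
    by (simp add: assms(2))
  moreover have "isCont (\<lambda>X. center X k) X" for k
    by (rule linear_continuous_at[OF bounded_linear_center])
  then have "isCont ?G X"
    using assms(1) by (intro continuous_add isCont_circle_block continuous_minus isCont_sgn continuous_diff) auto
  ultimately show ?thesis
    using has_derivative_scaleR_zero[of "\<lambda>X. - ((1 - q) / 4) * circle_error i j X"
        "\<lambda>v. - ((1 - q) / 4) * (v \<bullet> circle_gradient i j u)" X ?G]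
    unfolding cc_module_eq u by blast
qed

section \<open>Size of the gradients, rank-one matrices and the domain\<close>

lemma power2_four_le: "(a + b + c + d)\<^sup>2 \<le> 4 * (a\<^sup>2 + b\<^sup>2 + c\<^sup>2 + (d::real)\<^sup>2)"
proof -
  have "4 * (a\<^sup>2 + b\<^sup>2 + c\<^sup>2 + d\<^sup>2) - (a + b + c + d)\<^sup>2
      = (a - b)\<^sup>2 + (a - c)\<^sup>2 + (a - d)\<^sup>2 + (b - c)\<^sup>2 + (b - d)\<^sup>2 + (c - d)\<^sup>2"
    by (simp add: power2_eq_square algebra_simps)
  also have "\<dots> \<ge> 0"
    by simp
  finally show ?thesis
    by simp
qed

lemma inner_unit_power2_le:
  fixes n p :: "'a::real_inner"
  assumes "norm n = 1"
  shows "(n \<bullet> p)\<^sup>2 \<le> p \<bullet> p"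
  using Cauchy_Schwarz_ineq[of n p] assms by (simp add: norm_eq_1)

text \<open>The gradient has squared length 2 and lives in the block of circle
  \<open>i\<close>.\<close>

lemma inner_line_gradient_power2_le:
  assumes "norm n = 1"
  shows "(v \<bullet> line_gradient i n)\<^sup>2 \<le> 2 * (center v i \<bullet> center v i + (radius v i)\<^sup>2)"
proof -
  have "(v \<bullet> line_gradient i n)\<^sup>2 = (radius v i - n \<bullet> center v i)\<^sup>2"
    by (simp add: inner_commute[of v] inner_circle_block)
  also have "\<dots> \<le> 2 * ((n \<bullet> center v i)\<^sup>2 + (radius v i)\<^sup>2)"
    using zero_le_power2[of "radius v i + n \<bullet> center v i"] by (simp add: power2_eq_square algebra_simps)
  also have "\<dots> \<le> 2 * (center v i \<bullet> center v i + (radius v i)\<^sup>2)"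
    using inner_unit_power2_le[OF assms] by simp
  finally show ?thesis .
qed

text \<open>For \<open>i \<noteq> j\<close> the factor 4 is the squared length of the gradient,
  spread over the blocks of both circles.\<close>

lemma inner_circle_gradient_power2_le:
  assumes "norm u = 1"
  shows "(v \<bullet> circle_gradient i j u)\<^sup>2
    \<le> 4 * ((center v i \<bullet> center v i + (radius v i)\<^sup>2) + (center v j \<bullet> center v j + (radius v j)\<^sup>2))"
proof -
  have "v \<bullet> circle_gradient i j u
      = (- (u \<bullet> center v i)) + (- radius v i) + (u \<bullet> center v j) + (- radius v j)"
    by (simp add: inner_commute[of v] inner_add_left inner_circle_block)
  then have "(v \<bullet> circle_gradient i j u)\<^sup>2
      \<le> 4 * ((- (u \<bullet> center v i))\<^sup>2 + (- radius v i)\<^sup>2 + (u \<bullet> center v j)\<^sup>2 + (- radius v j)\<^sup>2)"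
    by (simp only: power2_four_le)
  then show ?thesis
    using inner_unit_power2_le[OF assms, of "center v i"] inner_unit_power2_le[OF assms, of "center v j"]
    by simp
qed

lemma outer_square_mult: "outer_square w *v v = (v \<bullet> w) *\<^sub>R w"
  by (simp add: outer_square_def columnvector_def rowvector_def matrix_matrix_mult_def
      matrix_vector_mult_def vec_eq_iff inner_vec_def sum_distrib_left sum_distrib_right mult_ac)

lemma open_update_domain: "open (update_domain A B C)"
proof -
  have line: "open {X. center X i \<notin> line_through U V}" for i U V
  proof -
    have "closed ((\<lambda>X. center X i) -` line_through U V)"
      unfolding line_through_def
      by (intro closed_vimage closed_affine_hull continuous_on_center)
    then have "open (- ((\<lambda>X. center X i) -` line_through U V))"
      by (rule open_Compl)
    then show ?thesis
      by (simp add: vimage_def Collect_neg_eq)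
  qed
  have inj: "inj (center X) \<longleftrightarrow> center X 1 \<noteq> center X 2 \<and> center X 2 \<noteq> center X 3 \<and> center X 1 \<noteq> center X 3" for X
    by (auto simp: inj_def forall_3)
  have neq: "open {X. center X i \<noteq> center X j}" for i j
    by (intro open_Collect_neq continuous_on_center)
  show ?thesis
    unfolding update_domain_def line_contacts_def inj
    by (simp only: set_simps ball_simps prod.case simp_thms)
      (intro open_Collect_conj line neq)
qed

section \<open>The matrix \<open>M\<close> at the Malfatti configuration\<close>

text \<open>\<open>na\<close>, \<open>nb\<close>, \<open>nc\<close> are the inward normals of the
  sides opposite \<open>A\<close>, \<open>B\<close>, \<open>C\<close>, and the circles 1, 2, 3
  belong to the angles at \<open>A\<close>, \<open>B\<close>, \<open>C\<close>.\<close>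

locale malfatti_contacts =
  fixes A B C na nb nc :: "real ^ 2" and X :: "real ^ 9"
  assumes circle1: "angle_circle nc nb na A B C (center X 1) (radius X 1)"
    and circle2: "angle_circle nc na nb B A C (center X 2) (radius X 2)"
    and circle3: "angle_circle nb na nc C A B (center X 3) (radius X 3)"
    and tangent12: "norm (center X 2 - center X 1) = radius X 1 + radius X 2"
    and tangent23: "norm (center X 3 - center X 2) = radius X 2 + radius X 3"
    and tangent13: "norm (center X 3 - center X 1) = radius X 1 + radius X 3"
begin

definition "u12 = sgn (center X 2 - center X 1)"
definition "u23 = sgn (center X 3 - center X 2)"
definition "u13 = sgn (center X 3 - center X 1)"

lemma normals:
  "inward_normal nc A B C" "inward_normal nb A C B" "inward_normal na B C A" "inward_normal nb C A B"
  using circle1 circle3 by (simp_all add: angle_circle_def)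

lemma radius_pos: "radius X 1 > 0" "radius X 2 > 0" "radius X 3 > 0"
  using circle1 circle2 circle3 by (simp_all add: angle_circle_def)

lemma distances:
  "nc \<bullet> (center X 1 - A) = radius X 1" "nb \<bullet> (center X 1 - A) = radius X 1"
  "nc \<bullet> (center X 2 - A) = radius X 2" "na \<bullet> (center X 2 - B) = radius X 2"
  "na \<bullet> (center X 3 - B) = radius X 3" "nb \<bullet> (center X 3 - C) = radius X 3"
  using circle1 circle2 circle3 inward_normal_base[OF normals(1), of "center X 2"]
    inward_normal_base[OF normals(3), of "center X 3"]
  by (simp_all add: angle_circle_def)

lemma centers_distinct:
  "center X 1 \<noteq> center X 2" "center X 2 \<noteq> center X 3" "center X 1 \<noteq> center X 3"
  using tangent12 tangent23 tangent13 radius_pos by auto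

lemma norm_normals: "norm na = 1" "norm nb = 1" "norm nc = 1"
  using normals by (simp_all add: inward_normal_def)

lemma norm_directions: "norm u12 = 1" "norm u23 = 1" "norm u13 = 1"
  using centers_distinct by (simp_all add: u12_def u23_def u13_def norm_sgn)

lemma circle_errors_zero: "circle_error 1 2 X = 0" "circle_error 2 3 X = 0" "circle_error 1 3 X = 0"
  using tangent12 tangent23 tangent13 by (simp_all add: circle_error_def)

lemma line_gradients:
  "gradient (line_error 1 (line_through A B)) X = line_gradient 1 nc"
  "gradient (line_error 1 (line_through A C)) X = line_gradient 1 nb"
  "gradient (line_error 2 (line_through A B)) X = line_gradient 2 nc"
  "gradient (line_error 2 (line_through B C)) X = line_gradient 2 na"
  "gradient (line_error 3 (line_through B C)) X = line_gradient 3 na"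
  "gradient (line_error 3 (line_through C A)) X = line_gradient 3 nb"
  by (rule gradient_eqI, unfold gderiv_def, rule line_error_has_derivative, rule normals,
      simp add: distances radius_pos)+

lemma circle_gradients:
  "gradient (circle_error 1 2) X = circle_gradient 1 2 u12"
  "gradient (circle_error 2 3) X = circle_gradient 2 3 u23"
  "gradient (circle_error 1 3) X = circle_gradient 1 3 u13"
  unfolding u12_def u23_def u13_def
  by (rule gradient_eqI, unfold gderiv_def, rule circle_error_has_derivative, rule centers_distinct)+

section \<open>Symmetry, upper bound and definiteness of the matrix\<close>

lemma malfatti_matrix_mult:
  "malfatti_matrix A B C X *v v =
    (1 / 2) *\<^sub>R ((v \<bullet> line_gradient 1 nc) *\<^sub>R line_gradient 1 nc + ((v \<bullet> line_gradient 1 nb) *\<^sub>R line_gradient 1 nb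
      + ((v \<bullet> line_gradient 2 nc) *\<^sub>R line_gradient 2 nc + ((v \<bullet> line_gradient 2 na) *\<^sub>R line_gradient 2 na
      + ((v \<bullet> line_gradient 3 na) *\<^sub>R line_gradient 3 na + (v \<bullet> line_gradient 3 nb) *\<^sub>R line_gradient 3 nb)))))
    + (1 / 4) *\<^sub>R ((v \<bullet> circle_gradient 1 2 u12) *\<^sub>R circle_gradient 1 2 u12
      + ((v \<bullet> circle_gradient 2 3 u23) *\<^sub>R circle_gradient 2 3 u23
      + (v \<bullet> circle_gradient 1 3 u13) *\<^sub>R circle_gradient 1 3 u13))"
  unfolding malfatti_matrix_def line_contacts_def circle_contacts_def list.map sum_list.Cons sum_list.Nil
    prod.case line_gradients circle_gradients add_0_right
    matrix_vector_mult_add_rdistrib scaleR_matrix_vector_assoc[symmetric] outer_square_mult ..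

lemma malfatti_matrix_symmetric:
  "(malfatti_matrix A B C X *v x) \<bullet> y = x \<bullet> (malfatti_matrix A B C X *v y)"
  unfolding malfatti_matrix_mult inner_add_left[of "_ *\<^sub>R _"] inner_add_right[of _ "_ *\<^sub>R _"]
    inner_scaleR_left inner_scaleR_right inner_commute[of _ y]
  by (simp only: mult_ac)

lemma malfatti_matrix_form:
  "v \<bullet> (malfatti_matrix A B C X *v v) =
    (1 / 2) * ((v \<bullet> line_gradient 1 nc)\<^sup>2 + ((v \<bullet> line_gradient 1 nb)\<^sup>2
      + ((v \<bullet> line_gradient 2 nc)\<^sup>2 + ((v \<bullet> line_gradient 2 na)\<^sup>2
      + ((v \<bullet> line_gradient 3 na)\<^sup>2 + (v \<bullet> line_gradient 3 nb)\<^sup>2)))))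
    + (1 / 4) * ((v \<bullet> circle_gradient 1 2 u12)\<^sup>2
      + ((v \<bullet> circle_gradient 2 3 u23)\<^sup>2 + (v \<bullet> circle_gradient 1 3 u13)\<^sup>2))"
  unfolding malfatti_matrix_mult inner_add_right[of _ "_ *\<^sub>R _"] inner_scaleR_right power2_eq_square ..

text \<open>Per circle, two line contacts contribute \<open>1 / 2 * 2\<close> each and two circle
  contacts \<open>1 / 4 * 4\<close> each, in total 4 times the squared length of its block.\<close>

lemma malfatti_matrix_form_le: "v \<bullet> (malfatti_matrix A B C X *v v) \<le> 4 * (v \<bullet> v)"
proof -
  have bound: "1 / 2 * (l1 + (l2 + (l3 + (l4 + (l5 + l6))))) + 1 / 4 * (c1 + (c2 + c3)) \<le> 4 * (x + y + z)"
    if "l1 \<le> 2 * x" "l2 \<le> 2 * x" "l3 \<le> 2 * y" "l4 \<le> 2 * y" "l5 \<le> 2 * z" "l6 \<le> 2 * z"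
      "c1 \<le> 4 * (x + y)" "c2 \<le> 4 * (y + z)" "c3 \<le> 4 * (x + z)"
    for l1 l2 l3 l4 l5 l6 c1 c2 c3 x y z :: real
    using that by argo
  show ?thesis
    unfolding malfatti_matrix_form inner_self_state[of v]
    by (intro bound inner_line_gradient_power2_le inner_circle_gradient_power2_le norm_normals norm_directions)
qed

lemma gradients_span:
  assumes line: "v \<bullet> line_gradient 1 nc = 0" "v \<bullet> line_gradient 1 nb = 0" "v \<bullet> line_gradient 2 nc = 0"
      "v \<bullet> line_gradient 2 na = 0" "v \<bullet> line_gradient 3 na = 0" "v \<bullet> line_gradient 3 nb = 0"
    and circle: "v \<bullet> circle_gradient 1 2 u12 = 0" "v \<bullet> circle_gradient 2 3 u23 = 0"
      "v \<bullet> circle_gradient 1 3 u13 = 0"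
  shows "v = 0"
proof -
  \<comment> \<open>The relative growth rates of the three circles, which are also their homothety
    rates.\<close>
  define a b c where "a = radius v 1 / radius X 1" and "b = radius v 2 / radius X 2"
    and "c = radius v 3 / radius X 3"
  have s: "radius v 1 = a * radius X 1" "radius v 2 = b * radius X 2" "radius v 3 = c * radius X 3"
    using radius_pos by (simp_all add: a_def b_def c_def)
  have n: "nc \<bullet> center v 1 = radius v 1" "nb \<bullet> center v 1 = radius v 1" "nc \<bullet> center v 2 = radius v 2"
    "na \<bullet> center v 2 = radius v 2" "na \<bullet> center v 3 = radius v 3" "nb \<bullet> center v 3 = radius v 3"
    using line by (simp_all add: inner_commute[of v] inner_circle_block)
  have p: "center v 1 = a *\<^sub>R (center X 1 - A)" "center v 2 = b *\<^sub>R (center X 2 - B)"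
    "center v 3 = c *\<^sub>R (center X 3 - C)"
    unfolding a_def b_def c_def
    by (rule kernel_at_vertex[OF circle1 n(1,2)] kernel_at_vertex[OF circle2 n(3,4)]
        kernel_at_vertex[OF circle3 n(6,5)])+
  have h: "sgn (center X 2 - center X 1) \<bullet> (b *\<^sub>R (center X 2 - B) - a *\<^sub>R (center X 1 - A))
      = a * radius X 1 + b * radius X 2"
    "sgn (center X 3 - center X 2) \<bullet> (c *\<^sub>R (center X 3 - C) - b *\<^sub>R (center X 2 - B))
      = b * radius X 2 + c * radius X 3"
    "sgn (center X 3 - center X 1) \<bullet> (c *\<^sub>R (center X 3 - C) - a *\<^sub>R (center X 1 - A))
      = a * radius X 1 + c * radius X 3"
    using circle unfolding p[symmetric] s[symmetric] u12_def[symmetric] u23_def[symmetric] u13_def[symmetric]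
    by (simp_all add: inner_commute[of v] inner_add_left inner_circle_block inner_diff_right)
  \<comment> \<open>Each of the three pairs has opposite signs or is zero, and three nonzero signs
    cannot alternate around a cycle. The swaps bring the side shared by the two circles to the
    front.\<close>
  have "a = 0 \<and> b = 0 \<and> c = 0"
    using opposite_scaling[OF circle1 circle2 tangent12 h(1)]
      opposite_scaling[OF angle_circle_swap[OF circle2] angle_circle_swap[OF circle3] tangent23 h(2)]
      opposite_scaling[OF angle_circle_swap[OF circle1] circle3 tangent13 h(3)]
    by linarith
  then have "center v i = 0" "radius v i = 0" for i
    using p s exhaust_3[of i] by auto
  then show "v = 0"
    by (intro state_eqI) simp_all
qed

text \<open>The form is a positively weighted sum of squares; if it is not positive,
  \<open>v\<close> is orthogonal to all nine gradients and \<open>gradients_span\<close>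
  applies.\<close>

lemma malfatti_matrix_pos_def:
  assumes "v \<noteq> 0"
  shows "0 < v \<bullet> (malfatti_matrix A B C X *v v)"
proof (rule ccontr)
  have zero: "l1 = 0 \<and> l2 = 0 \<and> l3 = 0 \<and> l4 = 0 \<and> l5 = 0 \<and> l6 = 0 \<and> c1 = 0 \<and> c2 = 0 \<and> c3 = 0"
    if "\<not> 0 < 1 / 2 * (l1\<^sup>2 + (l2\<^sup>2 + (l3\<^sup>2 + (l4\<^sup>2 + (l5\<^sup>2 + l6\<^sup>2))))) + 1 / 4 * (c1\<^sup>2 + (c2\<^sup>2 + c3\<^sup>2))"
    for l1 l2 l3 l4 l5 l6 c1 c2 c3 :: real
  proof -
    have "1 / 2 * (l1\<^sup>2 + (l2\<^sup>2 + (l3\<^sup>2 + (l4\<^sup>2 + (l5\<^sup>2 + l6\<^sup>2))))) + 1 / 4 * (c1\<^sup>2 + (c2\<^sup>2 + c3\<^sup>2)) = 0"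
      using that by (intro antisym) (simp_all only: not_less, simp)
    then show ?thesis
      by (simp add: add_nonneg_eq_0_iff)
  qed
  assume "\<not> ?thesis"
  then have "\<not> 0 < 1 / 2 * ((v \<bullet> line_gradient 1 nc)\<^sup>2 + ((v \<bullet> line_gradient 1 nb)\<^sup>2
      + ((v \<bullet> line_gradient 2 nc)\<^sup>2 + ((v \<bullet> line_gradient 2 na)\<^sup>2
      + ((v \<bullet> line_gradient 3 na)\<^sup>2 + (v \<bullet> line_gradient 3 nb)\<^sup>2)))))
    + (1 / 4) * ((v \<bullet> circle_gradient 1 2 u12)\<^sup>2
      + ((v \<bullet> circle_gradient 2 3 u23)\<^sup>2 + (v \<bullet> circle_gradient 1 3 u13)\<^sup>2))"
    unfolding malfatti_matrix_form .
  from zero[OF this] show False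
    using gradients_span assms by blast
qed

section \<open>The update map at the Malfatti state\<close>

lemma update_map_fixed: "update_map A B C q X = X"
proof -
  have "lc_module q 1 (line_through A B) X = 0" "lc_module q 1 (line_through A C) X = 0"
    "lc_module q 2 (line_through A B) X = 0" "lc_module q 2 (line_through B C) X = 0"
    "lc_module q 3 (line_through B C) X = 0" "lc_module q 3 (line_through C A) X = 0"
    by (subst lc_module_eq, rule normals, simp add: distances radius_pos,
        subst line_error_eq, rule normals, simp add: distances radius_pos, simp add: distances)+
  then show ?thesis
    by (simp add: update_map_def line_contacts_def circle_contacts_def cc_module_eq circle_errors_zero)
qed

lemma update_map_has_derivative:
  "(update_map A B C q has_derivative (\<lambda>v. v - (1 - q) *\<^sub>R (malfatti_matrix A B C X *v v))) (at X)"
proof -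
  note lc = lc_module_has_derivative
  note cc = cc_module_has_derivative
  have derivative: "(update_map A B C q has_derivative (\<lambda>v. v +
      ((- ((1 - q) / 2) * (v \<bullet> line_gradient 1 nc)) *\<^sub>R line_gradient 1 nc +
      ((- ((1 - q) / 2) * (v \<bullet> line_gradient 1 nb)) *\<^sub>R line_gradient 1 nb +
      ((- ((1 - q) / 2) * (v \<bullet> line_gradient 2 nc)) *\<^sub>R line_gradient 2 nc +
      ((- ((1 - q) / 2) * (v \<bullet> line_gradient 2 na)) *\<^sub>R line_gradient 2 na +
      ((- ((1 - q) / 2) * (v \<bullet> line_gradient 3 na)) *\<^sub>R line_gradient 3 na +
       (- ((1 - q) / 2) * (v \<bullet> line_gradient 3 nb)) *\<^sub>R line_gradient 3 nb))))) +
      ((- ((1 - q) / 4) * (v \<bullet> circle_gradient 1 2 u12)) *\<^sub>R circle_gradient 1 2 u12 +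
      ((- ((1 - q) / 4) * (v \<bullet> circle_gradient 2 3 u23)) *\<^sub>R circle_gradient 2 3 u23 +
       (- ((1 - q) / 4) * (v \<bullet> circle_gradient 1 3 u13)) *\<^sub>R circle_gradient 1 3 u13)))) (at X)"
    unfolding update_map_def line_contacts_def circle_contacts_def list.map sum_list.Cons sum_list.Nil
      prod.case add_0_right
    by (intro has_derivative_add has_derivative_ident
        lc[OF normals(1) distances(1) radius_pos(1)] lc[OF normals(2) distances(2) radius_pos(1)]
        lc[OF normals(1) distances(3) radius_pos(2)] lc[OF normals(3) distances(4) radius_pos(2)]
        lc[OF normals(3) distances(5) radius_pos(3)] lc[OF normals(4) distances(6) radius_pos(3)]
        cc[OF centers_distinct(1) circle_errors_zero(1) u12_def]
        cc[OF centers_distinct(2) circle_errors_zero(2) u23_def]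
        cc[OF centers_distinct(3) circle_errors_zero(3) u13_def])
  \<comment> \<open>Regrouping into the identity minus \<open>(1 - q)\<close> times the matrix,
    stated for arbitrary vectors so that the gradients stay opaque.\<close>
  have "v + (c *\<^sub>R a1 + (c *\<^sub>R a2 + (c *\<^sub>R a3 + (c *\<^sub>R a4 + (c *\<^sub>R a5 + c *\<^sub>R a6))))) +
      (d *\<^sub>R b1 + (d *\<^sub>R b2 + d *\<^sub>R b3)) =
      v - (1 - q) *\<^sub>R ((1 / 2) *\<^sub>R (a1 + (a2 + (a3 + (a4 + (a5 + a6))))) + (1 / 4) *\<^sub>R (b1 + (b2 + b3)))"
    if "c = - ((1 - q) / 2)" "d = - ((1 - q) / 4)" for c d and v a1 a2 a3 a4 a5 a6 b1 b2 b3 :: "real ^ 9"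
    unfolding that by (simp add: vec_eq_iff algebra_simps)
  note scaled = this[OF refl refl, symmetric]
  show ?thesis
    unfolding malfatti_matrix_mult scaled scaleR_scaleR by (rule derivative)
qed

lemma in_update_domain: "X \<in> update_domain A B C"
proof -
  have "inj (center X)"
    using centers_distinct by (auto simp: inj_def forall_3)
  then show ?thesis
    using distances radius_pos
    unfolding update_domain_def line_contacts_def line_through_eq[OF normals(1)]
      line_through_eq[OF normals(2)] line_through_eq[OF normals(3)] line_through_eq[OF normals(4)]
    by (simp add: line_through_eq[OF normals(1)]
      line_through_eq[OF normals(2)] line_through_eq[OF normals(3)] line_through_eq[OF normals(4)])
qed

text \<open>Common source of both claims of the theorem: \<open>l\<close> will be the largest
  eigenvalue for the first and 4 for the second.\<close>

lemma stable_of_form_le: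
  assumes "\<And>v. v \<bullet> (malfatti_matrix A B C X *v v) \<le> l * (v \<bullet> v)" and "q < 1" "(1 - q) * l < 2"
  shows "locally_asymptotically_stable_fixed_point (update_map A B C q) (update_domain A B C) X"
proof -
  obtain b :: "real ^ 9" where "b \<in> Basis"
    using nonempty_Basis by blast
  \<comment> \<open>At a unit vector the form is positive and at most \<open>l\<close>.\<close>
  then have "0 < l"
    using malfatti_matrix_pos_def[of b] assms(1)[of b] by (auto simp: inner_Basis nonzero_Basis)
  then obtain r where r: "0 \<le> r" "r < 1"
      "\<And>v. norm (v - (1 - q) *\<^sub>R (malfatti_matrix A B C X *v v)) \<le> r * norm v"
    using pos_def_relaxation_contracts[OF matrix_vector_mul_linear malfatti_matrix_symmetric
        malfatti_matrix_pos_def assms(1), of "1 - q"] assms(2,3) by auto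
  then show ?thesis
    by (rule linearly_stable_fixed_point[OF open_update_domain in_update_domain update_map_fixed
          update_map_has_derivative])
qed

end

section \<open>From the definition of the configuration to the theorem\<close>

lemma malfatti_contacts_exist:
  assumes "\<not> collinear {A, B, C}" and X: "malfatti_configuration A B C X"
  shows "\<exists>na nb nc. malfatti_contacts A B C na nb nc X"
proof -
  have "\<not> collinear {A, C, B}" "\<not> collinear {B, C, A}"
    using assms(1) by (simp_all add: insert_commute)
  then obtain na nb nc where
    n: "inward_normal nc A B C" "inward_normal nb A C B" "inward_normal na B C A"
    using inward_normal_exists[of A B C] inward_normal_exists[of A C B] inward_normal_exists[of B C A]
      assms(1) by blast
  \<comment> \<open>Each circle needs its own vertex as first endpoint of its two sides, hence the
    reversed sides and permuted hulls.\<close>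
  note n' = n[THEN inward_normal_flip]
  have pos: "0 < radius X i" and hull: "sphere (center X i) (radius X i) \<subseteq> convex hull {A, B, C}" for i
    using X by (simp_all add: malfatti_configuration_def)
  have hull': "sphere (center X i) (radius X i) \<subseteq> convex hull {B, A, C}"
    "sphere (center X i) (radius X i) \<subseteq> convex hull {C, A, B}" for i
    using hull[of i] by (simp_all add: insert_commute)
  have side: "tangent_to_side (center X 1) (radius X 1) A B" "tangent_to_side (center X 1) (radius X 1) A C"
    "tangent_to_side (center X 2) (radius X 2) B A" "tangent_to_side (center X 2) (radius X 2) B C"
    "tangent_to_side (center X 3) (radius X 3) C B" "tangent_to_side (center X 3) (radius X 3) C A"
    using X tangent_to_side_commute by (auto simp: malfatti_configuration_def line_contacts_def)
  have ext: "externally_tangent (center X 1) (radius X 1) (center X 2) (radius X 2)"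
    "externally_tangent (center X 2) (radius X 2) (center X 3) (radius X 3)"
    "externally_tangent (center X 1) (radius X 1) (center X 3) (radius X 3)"
    using X by (simp_all add: malfatti_configuration_def circle_contacts_def)
  have "malfatti_contacts A B C na nb nc X"
  proof
    show "angle_circle nc nb na A B C (center X 1) (radius X 1)"
      by (rule angle_circleI[OF n pos hull side(1,2)])
    show "angle_circle nc na nb B A C (center X 2) (radius X 2)"
      by (rule angle_circleI[OF n'(1) n(3) n(2) pos hull'(1) side(3,4)])
    show "angle_circle nb na nc C A B (center X 3) (radius X 3)"
      by (rule angle_circleI[OF n'(2) n'(3) n(1) pos hull'(2) side(6,5)])
  qed (rule externally_tangentD[OF ext(1) pos pos] externally_tangentD[OF ext(2) pos pos]
      externally_tangentD[OF ext(3) pos pos])+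
  then show ?thesis
    by blast
qed

theorem theorem2:
  fixes A B C :: "real ^ 2" and X_Mal :: "real ^ 9"
  assumes nondegenerate: "\<not> collinear {A, B, C}"
    and malfatti: "malfatti_configuration A B C X_Mal"
  shows "(\<forall>q::real. -1 < q \<and> q < 1 \<and>
            1 - 2 / max_eigenvalue (malfatti_matrix A B C X_Mal) < q \<longrightarrow>
            locally_asymptotically_stable_fixed_point
              (update_map A B C q) (update_domain A B C) X_Mal)
       \<and> (\<forall>q::real. 1 / 2 < q \<and> q < 1 \<longrightarrow>
            locally_asymptotically_stable_fixed_point
              (update_map A B C q) (update_domain A B C) X_Mal)"
proof -
  obtain na nb nc where "malfatti_contacts A B C na nb nc X_Mal"
    using malfatti_contacts_exist[OF nondegenerate malfatti] by blast
  then interpret malfatti_contacts A B C na nb nc X_Mal .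
  let ?M = "malfatti_matrix A B C X_Mal"
  note rayleigh = rayleigh_le_max_eigenvalue[of ?M, OF malfatti_matrix_symmetric]
  obtain b :: "real ^ 9" where "b \<in> Basis"
    using nonempty_Basis by blast
  \<comment> \<open>Positivity permits clearing the denominator in the condition on
    \<open>q\<close>.\<close>
  then have "0 < max_eigenvalue ?M"
    using malfatti_matrix_pos_def[of b] rayleigh[of b] by (auto simp: inner_Basis nonzero_Basis)
  then have "(1 - q) * max_eigenvalue ?M < 2" if "1 - 2 / max_eigenvalue ?M < q" for q
    using that by (simp add: field_simps)
  then show ?thesis
    \<comment> \<open>With the bound 4, the requirement \<open>(1 - q) * 4 < 2\<close> is exactly
      \<open>1 / 2 < q\<close>.\<close>
    using stable_of_form_le[OF rayleigh] stable_of_form_le[OF malfatti_matrix_form_le] by auto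
qed

end
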